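(* The energy game problem (computing the minimal energies $e^*_{G,w}(v)$ of all nodes of a weighted game graph) on arbitrary graphs is polynomial-time equivalent to the energy game problem restricted to graphs of bounded clique-width, and also polynomial-time equivalent to the energy game problem restricted to strongly ergodic graphs.
   Context: A weighted game graph $(G,w)$ consists of a finite directed graph $G=(V,E)$ in which every node has out-degree at least $1$, a partition $V=V_A\cup V_B$ into nodes of Alice and of Bob, and integer edge weights $w:E\to\mathbb{Z}$. A (positional) strategy $\sigma$ of Alice picks for each $u\in V_A$ an out-neighbor $\sigma(u)$; a strategy $\tau$ of Bob picks for each $u\in V_B$ an out-neighbor $\tau(u)$. $G(\sigma,\tau)$ is the subgraph with edges $\{(u,\sigma(u)):u\in V_A\}\cup\{(u,\tau(u)):u\in V_B\}$; from any node $s$ there is a unique cycle $C$ reachable in it. $w(P)$ is the total weight of a path/cycle $P$. Set $e^*_{G(\sigma,\tau),w}(s)=\infty$ if $w(C)<0$, else $\max\{0,-\min_P w(P)\}$ over simple paths $P$ in $G(\sigma,\tau)$ starting at $s$. The minimal energy is $e^*_{G,w}(s)=\min_\sigma\max_\tau e^*_{G(\sigma,\tau),w}(s)$. Clique-width: the minimum number of labels needed to construct the directed graph using the operations (1) create a new node with label $i$; (2) disjoint union of two labeled graphs; (3) add an edge $(u,v)$ for every node $u$ with label $i$ and every node $v$ with label $j$; (4) rename label $i$ to label $j$. Ergodicity: an ergodic partition is a partition $(S_A,S_B)$ of $V$ such that (1) every $u\in S_A\cap V_A$ has an out-neighbor in $S_A$; (2) no edge goes from $S_A\cap V_B$ to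 $S_B$; (3) every $u\in S_B\cap V_B$ has an out-neighbor in $S_B$; (4) no edge goes from $S_B\cap V_A$ to $S_A$. It is trivial if $S_A=\emptyset$ or $S_B=\emptyset$. A graph is ergodic if it has no non-trivial ergodic partition, and strongly ergodic if every induced subgraph in which every node has out-degree at least $1$ is ergodic. *)

theory Defs
  imports
    "Graph_Theory.Graph_Theory"
    "HOL-Library.FuncSet"
    "HOL-Library.Extended_Nat"
    "HOL-Library.Log_Nat"
    "HOL-Computational_Algebra.Polynomial"
begin

record 'v game_graph =
  arena :: "'v pair_pre_digraph"
  alice :: "'v set"
  bob :: "'v set"

definition game_graph :: "'v game_graph \<Rightarrow> bool" where
  "game_graph G \<longleftrightarrow>
     pair_fin_digraph (arena G) \<and>
     alice G \<union> bob G = pverts (arena G) \<and> alice G \<inter> bob G = {} \<and>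
     (\<forall>u \<in> pverts (arena G). out_degree (with_proj (arena G)) u \<ge> 1)"

definition out_neighbors :: "'v pair_pre_digraph \<Rightarrow> 'v \<Rightarrow> 'v set" where
  "out_neighbors H u = {v. (u, v) \<in> parcs H}"

text \<open>Strategies are extensional functions, so that a finite game graph has finitely many of them
  and the minimum and maximum in the definition of the minimal energy are over finite sets.\<close>

definition alice_strategies :: "'v game_graph \<Rightarrow> ('v \<Rightarrow> 'v) set" where
  "alice_strategies G = Pi\<^sub>E (alice G) (out_neighbors (arena G))"

definition bob_strategies :: "'v game_graph \<Rightarrow> ('v \<Rightarrow> 'v) set" where
  "bob_strategies G = Pi\<^sub>E (bob G) (out_neighbors (arena G))"

definition play_graph :: "'v game_graph \<Rightarrow> ('v \<Rightarrow> 'v) \<Rightarrow> ('v \<Rightarrow> 'v) \<Rightarrow> 'v pair_pre_digraph" where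
  "play_graph G \<sigma> \<tau> =
     \<lparr> pverts = pverts (arena G),
       parcs = {(u, \<sigma> u) | u. u \<in> alice G} \<union> {(u, \<tau> u) | u. u \<in> bob G} \<rparr>"

text \<open>Walks, paths and cycles are lists of arcs.\<close>

definition weight :: "('v \<times> 'v \<Rightarrow> int) \<Rightarrow> ('v \<times> 'v) list \<Rightarrow> int" where
  "weight w p = sum_list (map w p)"

text \<open>In a play graph every node has exactly one outgoing arc, so the cycle reachable from \<open>s\<close> is
  unique up to the choice of its first arc, and the choice does not affect its weight.
  The empty path at \<open>s\<close> is a simple path.\<close>

definition play_energy :: "'v pair_pre_digraph \<Rightarrow> ('v \<times> 'v \<Rightarrow> int) \<Rightarrow> 'v \<Rightarrow> enat" where
  "play_energy H w s =
     (if \<exists>C. pre_digraph.cycle (with_proj H) C \<and> s \<rightarrow>\<^sup>*\<^bsub>with_proj H\<^esub> fst (hd C) \<and> weight w C < 0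
      then \<infinity>
      else enat (nat (max 0 (- Min {weight w P | P. \<exists>v. pre_digraph.apath (with_proj H) s P v}))))"

definition min_energy :: "'v game_graph \<Rightarrow> ('v \<times> 'v \<Rightarrow> int) \<Rightarrow> 'v \<Rightarrow> enat" where
  "min_energy G w s =
     Min ((\<lambda>\<sigma>. Max ((\<lambda>\<tau>. play_energy (play_graph G \<sigma> \<tau>) w s) ` bob_strategies G))
          ` alice_strategies G)"

text \<open>\<open>cw_constructible k V E l\<close>: the digraph with vertices \<open>V\<close>, arcs \<open>E\<close> and vertex labelling \<open>l\<close>
  can be constructed with the labels \<open>0, \<dots>, k - 1\<close>. The empty graph is constructible without any
  operation. As \<open>i = j\<close> is permitted when adding arcs, loops can be created, and every finite
  digraph has a clique-width.\<close>

inductive cw_constructible :: "nat \<Rightarrow> 'v set \<Rightarrow> ('v \<times> 'v) set \<Rightarrow> ('v \<Rightarrow> nat) \<Rightarrow> bool" for k where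
  cw_empty: "cw_constructible k {} {} l"
| cw_node: "i < k \<Longrightarrow> cw_constructible k {v} {} (\<lambda>_. i)"
| cw_union: "cw_constructible k V\<^sub>1 E\<^sub>1 l\<^sub>1 \<Longrightarrow> cw_constructible k V\<^sub>2 E\<^sub>2 l\<^sub>2 \<Longrightarrow> V\<^sub>1 \<inter> V\<^sub>2 = {} \<Longrightarrow>
    cw_constructible k (V\<^sub>1 \<union> V\<^sub>2) (E\<^sub>1 \<union> E\<^sub>2) (\<lambda>v. if v \<in> V\<^sub>1 then l\<^sub>1 v else l\<^sub>2 v)"
| cw_arcs: "cw_constructible k V E l \<Longrightarrow> i < k \<Longrightarrow> j < k \<Longrightarrow>
    cw_constructible k V (E \<union> {(u, v). u \<in> V \<and> v \<in> V \<and> l u = i \<and> l v = j}) l"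
| cw_rename: "cw_constructible k V E l \<Longrightarrow> i < k \<Longrightarrow> j < k \<Longrightarrow>
    cw_constructible k V E (\<lambda>v. if l v = i then j else l v)"

definition clique_width :: "'v pair_pre_digraph \<Rightarrow> nat" where
  "clique_width H = (LEAST k. \<exists>l. cw_constructible k (pverts H) (parcs H) l)"

definition ergodic_partition :: "'v game_graph \<Rightarrow> 'v set \<Rightarrow> 'v set \<Rightarrow> bool" where
  "ergodic_partition G S\<^sub>A S\<^sub>B \<longleftrightarrow>
     S\<^sub>A \<union> S\<^sub>B = pverts (arena G) \<and> S\<^sub>A \<inter> S\<^sub>B = {} \<and>
     (\<forall>u \<in> S\<^sub>A \<inter> alice G. \<exists>v \<in> S\<^sub>A. (u, v) \<in> parcs (arena G)) \<and>
     (\<forall>u \<in> S\<^sub>A \<inter> bob G. \<forall>v \<in> S\<^sub>B. (u, v) \<notin> parcs (arena G)) \<and>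
     (\<forall>u \<in> S\<^sub>B \<inter> bob G. \<exists>v \<in> S\<^sub>B. (u, v) \<in> parcs (arena G)) \<and>
     (\<forall>u \<in> S\<^sub>B \<inter> alice G. \<forall>v \<in> S\<^sub>A. (u, v) \<notin> parcs (arena G))"

definition ergodic :: "'v game_graph \<Rightarrow> bool" where
  "ergodic G \<longleftrightarrow> (\<forall>S\<^sub>A S\<^sub>B. ergodic_partition G S\<^sub>A S\<^sub>B \<longrightarrow> S\<^sub>A = {} \<or> S\<^sub>B = {})"

definition induced_game :: "'v game_graph \<Rightarrow> 'v set \<Rightarrow> 'v game_graph" where
  "induced_game G S =
     \<lparr> arena = \<lparr> pverts = S, parcs = parcs (arena G) \<inter> S \<times> S \<rparr>,
       alice = alice G \<inter> S, bob = bob G \<inter> S \<rparr>"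

definition strongly_ergodic :: "'v game_graph \<Rightarrow> bool" where
  "strongly_ergodic G \<longleftrightarrow>
     (\<forall>S \<subseteq> pverts (arena G).
        (\<forall>u \<in> S. out_degree (with_proj (arena (induced_game G S))) u \<ge> 1)
          \<longrightarrow> ergodic (induced_game G S))"

text \<open>The machine model is a while language over binary trees with integer leaves. Each evaluation
  of a (sub)expression is charged the bit size of its value and each oracle call the bit sizes of
  query and answer, so that running times are polynomially related to those of (oracle) Turing
  machines.\<close>

datatype val = Leaf int | Node val val

primrec bit_size :: "val \<Rightarrow> nat" where
  "bit_size (Leaf i) = 1 + floorlog 2 (nat \<bar>i\<bar>)"
| "bit_size (Node a b) = 1 + bit_size a + bit_size b"

type_synonym state = "nat \<Rightarrow> val"

datatype expr =
  Var nat
| Const int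
| MkNode expr expr
| Left expr
| Right expr
| IsNode expr
| Plus expr expr
| Minus expr expr
| Leq expr expr

fun val_left :: "val \<Rightarrow> val" where
  "val_left (Node a b) = a"
| "val_left (Leaf i) = Leaf 0"

fun val_right :: "val \<Rightarrow> val" where
  "val_right (Node a b) = b"
| "val_right (Leaf i) = Leaf 0"

fun val_int :: "val \<Rightarrow> int" where
  "val_int (Leaf i) = i"
| "val_int (Node a b) = 0"

definition val_bool :: "bool \<Rightarrow> val" where
  "val_bool b = Leaf (if b then 1 else 0)"

primrec eval_expr :: "expr \<Rightarrow> state \<Rightarrow> val" where
  "eval_expr (Var x) s = s x"
| "eval_expr (Const i) s = Leaf i"
| "eval_expr (MkNode a b) s = Node (eval_expr a s) (eval_expr b s)"
| "eval_expr (Left a) s = val_left (eval_expr a s)"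
| "eval_expr (Right a) s = val_right (eval_expr a s)"
| "eval_expr (IsNode a) s = val_bool (\<exists>x y. eval_expr a s = Node x y)"
| "eval_expr (Plus a b) s = Leaf (val_int (eval_expr a s) + val_int (eval_expr b s))"
| "eval_expr (Minus a b) s = Leaf (val_int (eval_expr a s) - val_int (eval_expr b s))"
| "eval_expr (Leq a b) s = val_bool (val_int (eval_expr a s) \<le> val_int (eval_expr b s))"

primrec expr_cost :: "expr \<Rightarrow> state \<Rightarrow> nat" where
  "expr_cost (Var x) s = bit_size (eval_expr (Var x) s)"
| "expr_cost (Const i) s = bit_size (eval_expr (Const i) s)"
| "expr_cost (MkNode a b) s = expr_cost a s + expr_cost b s + bit_size (eval_expr (MkNode a b) s)"
| "expr_cost (Left a) s = expr_cost a s + bit_size (eval_expr (Left a) s)"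
| "expr_cost (Right a) s = expr_cost a s + bit_size (eval_expr (Right a) s)"
| "expr_cost (IsNode a) s = expr_cost a s + bit_size (eval_expr (IsNode a) s)"
| "expr_cost (Plus a b) s = expr_cost a s + expr_cost b s + bit_size (eval_expr (Plus a b) s)"
| "expr_cost (Minus a b) s = expr_cost a s + expr_cost b s + bit_size (eval_expr (Minus a b) s)"
| "expr_cost (Leq a b) s = expr_cost a s + expr_cost b s + bit_size (eval_expr (Leq a b) s)"

datatype com =
  Skip
| Assign nat expr
| Query nat expr
| Seq com com
| Cond expr com com
| While expr com

text \<open>\<open>exec f c s t s'\<close>: with oracle \<open>f\<close>, program \<open>c\<close> started in state \<open>s\<close> terminates in state \<open>s'\<close>
  after time \<open>t\<close>. A test fails iff its value is \<open>Leaf 0\<close>.\<close>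

inductive exec :: "(val \<Rightarrow> val) \<Rightarrow> com \<Rightarrow> state \<Rightarrow> nat \<Rightarrow> state \<Rightarrow> bool" for f where
  exec_Skip: "exec f Skip s 1 s"
| exec_Assign: "exec f (Assign x a) s (1 + expr_cost a s) (s(x := eval_expr a s))"
| exec_Query: "exec f (Query x a) s (1 + expr_cost a s + bit_size (f (eval_expr a s)))
    (s(x := f (eval_expr a s)))"
| exec_Seq: "exec f c\<^sub>1 s t\<^sub>1 s\<^sub>1 \<Longrightarrow> exec f c\<^sub>2 s\<^sub>1 t\<^sub>2 s\<^sub>2 \<Longrightarrow>
    exec f (Seq c\<^sub>1 c\<^sub>2) s (1 + t\<^sub>1 + t\<^sub>2) s\<^sub>2"
| exec_CondTrue: "eval_expr b s \<noteq> Leaf 0 \<Longrightarrow> exec f c\<^sub>1 s t s' \<Longrightarrow>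
    exec f (Cond b c\<^sub>1 c\<^sub>2) s (1 + expr_cost b s + t) s'"
| exec_CondFalse: "eval_expr b s = Leaf 0 \<Longrightarrow> exec f c\<^sub>2 s t s' \<Longrightarrow>
    exec f (Cond b c\<^sub>1 c\<^sub>2) s (1 + expr_cost b s + t) s'"
| exec_WhileFalse: "eval_expr b s = Leaf 0 \<Longrightarrow>
    exec f (While b c) s (1 + expr_cost b s) s"
| exec_WhileTrue: "eval_expr b s \<noteq> Leaf 0 \<Longrightarrow> exec f c s t\<^sub>1 s\<^sub>1 \<Longrightarrow>
    exec f (While b c) s\<^sub>1 t\<^sub>2 s\<^sub>2 \<Longrightarrow>
    exec f (While b c) s (1 + expr_cost b s + t\<^sub>1 + t\<^sub>2) s\<^sub>2"

text \<open>A problem relates each of its instances to the correct answers; values outside its domain are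
  not instances, and nothing is required on them.\<close>

type_synonym problem = "(val \<times> val) set"

definition oracle_for :: "(val \<Rightarrow> val) \<Rightarrow> problem \<Rightarrow> bool" where
  "oracle_for f Q \<longleftrightarrow> (\<forall>x \<in> Domain Q. (x, f x) \<in> Q)"

text \<open>Polynomial-time Turing reducibility: one program and one polynomial work for all oracles
  for \<open>Q\<close>. Input and output are in variable \<open>0\<close>.\<close>

definition poly_time_reducible :: "problem \<Rightarrow> problem \<Rightarrow> bool" where
  "poly_time_reducible P Q \<longleftrightarrow>
     (\<exists>c. \<exists>p :: nat poly. \<forall>f. oracle_for f Q \<longrightarrow>
        (\<forall>x \<in> Domain P. \<exists>t s.
           exec f c ((\<lambda>_. Leaf 0)(0 := x)) t s \<and> t \<le> poly p (bit_size x) \<and> (x, s 0) \<in> P))"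

definition poly_time_equivalent :: "problem \<Rightarrow> problem \<Rightarrow> bool" where
  "poly_time_equivalent P Q \<longleftrightarrow> poly_time_reducible P Q \<and> poly_time_reducible Q P"

definition encode_list :: "('a \<Rightarrow> val) \<Rightarrow> 'a list \<Rightarrow> val" where
  "encode_list enc xs = foldr (\<lambda>x v. Node (enc x) v) xs (Leaf 0)"

definition encode_game ::
    "nat game_graph \<Rightarrow> (nat \<times> nat \<Rightarrow> int) \<Rightarrow> nat list \<Rightarrow> (nat \<times> nat) list \<Rightarrow> val" where
  "encode_game G w ns es =
     Node (encode_list (\<lambda>u. Node (Leaf (int u)) (val_bool (u \<in> alice G))) ns)
          (encode_list (\<lambda>(u, v). Node (Node (Leaf (int u)) (Leaf (int v))) (Leaf (w (u, v)))) es)"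

fun encode_energy :: "enat \<Rightarrow> val" where
  "encode_energy (enat n) = Leaf (int n)"
| "encode_energy \<infinity> = Leaf (- 1)"

text \<open>An instance lists nodes (with owners) and arcs (with weights) in any order; the answer lists
  the minimal energies in the order of the nodes.\<close>

definition energy_problem :: "nat game_graph set \<Rightarrow> problem" where
  "energy_problem \<G> =
     {(encode_game G w ns es, encode_list (\<lambda>u. encode_energy (min_energy G w u)) ns) | G w ns es.
        G \<in> \<G> \<and> game_graph G \<and>
        distinct ns \<and> set ns = pverts (arena G) \<and> distinct es \<and> set es = parcs (arena G)}"

end

theory Submission
  imports Defs
begin

text \<open>Replace each vertex \<open>u\<close> of a game by a vertex of Alice and a vertex of Bob, one of which
  moves as \<open>u\<close> does while the other one only passes the turn to it, and add all the missing arcs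
  between the two sides. Completing the graph is harmless if the new arcs carry large penalties:
  when Alice uses one of them, she needs more energy than any finite minimal energy of the original
  game, and when Bob uses one, Alice gains enough to return to where she can win. So the finite
  minimal energies remain the same and the infinite ones exceed a threshold. A complete bipartite
  graph has clique-width at most 2. It is strongly ergodic, because in an ergodic partition
  with both parts nonempty there would be a vertex of Bob in \<open>S\<^sub>A\<close> and a vertex of Alice in \<open>S\<^sub>B\<close>,
  which are adjacent.

  The positional strategies are eliminated first: the minimal energy at \<open>s\<close> is at most \<open>n\<close> iff Alice
  has a positional strategy for which all walks from \<open>s\<close> have weight at least \<open>- n\<close>.\<close>

section \<open>Walks\<close>

text \<open>Only bounds \<open>n\<close> up to the sum \<open>S\<close> of the absolute values of
  all weights have to be compared in the two games, because a finite minimal energy never exceeds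
  \<open>S\<close>. This makes \<open>S\<close> the threshold and determines the penalties. Bob's
  penalty is larger than Alice's, so that luring her away and having her pay for the return does not
  profit him. The two inequalities have different proofs: a nonnegative potential on the biclique
  shows that Alice needs no more than in the original game, and lifting walks of the original game
  to the biclique shows that she needs no less. On the side of complexity, a problem is a relation
  and the oracle is arbitrary, so an instance has to determine its answer, and the answer has to be
  of polynomial size, before it can be used. Polynomial time is obtained from closure properties;
  the only recursion scheme is a list fold whose accumulator grows in each round by an amount that
  is bounded independently of the accumulator.\<close>

lemma weight_simps [simp]:
  "weight w [] = 0"
  "weight w (e # p) = w e + weight w p"
  "weight w (p @ q) = weight w p + weight w q"
  by (simp_all add: weight_def)

definition walk :: "('v \<times> 'v) set \<Rightarrow> 'v \<Rightarrow> ('v \<times> 'v) list \<Rightarrow> 'v \<Rightarrow> bool" where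
  "walk E u p v \<longleftrightarrow> set p \<subseteq> E \<and> pcas u p v"

lemma walk_Nil [simp]: "walk E u [] v \<longleftrightarrow> u = v"
  by (simp add: walk_def)

lemma walk_Cons [simp]: "walk E u (e # p) v \<longleftrightarrow> e \<in> E \<and> fst e = u \<and> walk E (snd e) p v"
  by (auto simp: walk_def)

lemma walk_append [simp]: "walk E u (p @ q) v \<longleftrightarrow> (\<exists>x. walk E u p x \<and> walk E x q v)"
  by (induction p arbitrary: u) auto

lemma walk_mono: "walk E u p v \<Longrightarrow> E \<subseteq> F \<Longrightarrow> walk F u p v"
  by (auto simp: walk_def)

lemma pawalk_verts_walk: "walk E u p v \<Longrightarrow> pawalk_verts u p = map fst p @ [v]"
  by (induction p arbitrary: u) auto

lemma awalk_with_proj_iff: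
  "pre_digraph.awalk (with_proj H) u p v \<longleftrightarrow> u \<in> pverts H \<and> walk (parcs H) u p v"
  by (auto simp: pre_digraph.awalk_def walk_def cas_with_proj_eq)

lemma walk_pump:
  assumes "walk E s q a" "walk E a c a" "weight w c < 0"
  shows "\<exists>p. walk E s p a \<and> weight w p < k"
proof -
  \<comment> \<open>Integer weights make each round of \<open>c\<close> cost at least 1, so this
    number of rounds uses up the surplus of \<open>q\<close> over \<open>k\<close>.\<close>
  define m where "m = nat (weight w q - k + 1)"
  have "walk E a (concat (replicate n c)) a \<and>
      weight w (concat (replicate n c)) = int n * weight w c" for n
    by (induction n) (use assms in \<open>auto simp: algebra_simps\<close>)
  then have walk: "walk E s (q @ concat (replicate m c)) a"
    and eq: "weight w (q @ concat (replicate m c)) = weight w q + int m * weight w c"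
    using assms by auto
  have "int m * weight w c \<le> - int m"
    using mult_left_mono[of "weight w c" "-1" "int m"] assms by simp
  moreover have "weight w q - k < int m"
    by (simp add: m_def)
  ultimately have "weight w q + int m * weight w c < k"
    by linarith
  with walk eq show ?thesis
    by metis
qed

text \<open>A walk either visits no vertex twice, or the first repetition cuts off a simple cycle at the
  end of a lasso. No vertex has two different successors on either of them, so both are consistent
  with a positional strategy.\<close>

lemma walk_simple_or_lasso:
  assumes "walk E s p v"
  shows "distinct (map fst p @ [v]) \<or>
    (\<exists>q c r a. p = q @ c @ r \<and> walk E s q a \<and> walk E a c a \<and> walk E a r v \<and> c \<noteq> [] \<and>
       distinct (map fst (q @ c)))"
  using assms
proof (induction p arbitrary: v rule: rev_induct)
  case (snoc e p)
  obtain x where e: "e = (x, v)" and E: "e \<in> E" and p: "walk E s p x"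
    using snoc.prems by (cases e) auto
  from snoc.IH[OF p] show ?case
  proof
    assume d: "distinct (map fst p @ [x])"
    show ?case
    proof (cases "v \<in> set (map fst (p @ [e]))")
      case True
      then obtain f where f: "f \<in> set (p @ [e])" "v = fst f" by (metis imageE list.set_map)
      then obtain q c where qc: "p @ [e] = q @ f # c" by (meson split_list)
      have "walk E s (q @ f # c) v" using snoc.prems qc by simp
      then have "walk E s q v" "walk E v (f # c) v" using f by auto
      moreover have "distinct (map fst (q @ f # c))"
        using d e by (simp flip: qc)
      ultimately show ?thesis
        by (intro disjI2 exI[of _ q] exI[of _ "f # c"] exI[of _ "[]"] exI[of _ v])
          (use qc in auto)
    qed (use d e in auto)
  next
    assume "\<exists>q c r a. p = q @ c @ r \<and> walk E s q a \<and> walk E a c a \<and> walk E a r x \<and> c \<noteq> [] \<and>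
       distinct (map fst (q @ c))"
    then obtain q c r a where "p = q @ c @ r" "walk E s q a" "walk E a c a" "walk E a r x"
      "c \<noteq> []" "distinct (map fst (q @ c))"
      by blast
    then show ?case
      by (intro disjI2 exI[of _ q] exI[of _ c] exI[of _ "r @ [e]"] exI[of _ a])
        (use e E in auto)
  qed
qed simp

text \<open>Cutting out a cycle of nonnegative weight shortens a walk and does not make it heavier,
  so induction on the length reduces every walk to a simple one.\<close>

lemma walk_weight_ge:
  assumes simple: "\<And>p v. walk E s p v \<Longrightarrow> distinct (map fst p @ [v]) \<Longrightarrow> k \<le> weight w p"
    and lasso: "\<And>q c a. walk E s q a \<Longrightarrow> walk E a c a \<Longrightarrow> c \<noteq> [] \<Longrightarrow> distinct (map fst (q @ c)) \<Longrightarrow>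
      0 \<le> weight w c"
    and "walk E s p v"
  shows "k \<le> weight w p"
  using \<open>walk E s p v\<close>
proof (induction p rule: length_induct)
  case (1 p)
  from walk_simple_or_lasso[OF "1.prems"] show ?case
  proof
    assume "\<exists>q c r a. p = q @ c @ r \<and> walk E s q a \<and> walk E a c a \<and> walk E a r v \<and> c \<noteq> [] \<and>
       distinct (map fst (q @ c))"
    then obtain q c r a where p: "p = q @ c @ r" and w: "walk E s q a" "walk E a c a"
      "walk E a r v" "c \<noteq> []" "distinct (map fst (q @ c))"
      by blast
    have "k \<le> weight w (q @ r)"
      using "1.IH"[rule_format, of "q @ r"] p w by auto
    with lasso[OF w(1,2,4,5)] show ?thesis
      by (simp add: p)
  qed (use simple "1.prems" in blast)
qed

lemma walk_imp_simple_walk: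
  assumes "walk E s p v"
  shows "\<exists>p. walk E s p v \<and> distinct (map fst p)"
  using assms
proof (induction p rule: length_induct)
  case (1 p)
  from walk_simple_or_lasso[OF "1.prems"] show ?case
  proof
    assume "\<exists>q c r a. p = q @ c @ r \<and> walk E s q a \<and> walk E a c a \<and> walk E a r v \<and> c \<noteq> [] \<and>
       distinct (map fst (q @ c))"
    then obtain q c r a where p: "p = q @ c @ r" and w: "walk E s q a" "walk E a c a"
      "walk E a r v" "c \<noteq> []"
      by blast
    then show ?thesis
      using "1.IH"[rule_format, of "q @ r"] by auto
  qed (use "1.prems" in auto)
qed

lemma abs_weight_le:
  assumes "finite E" "distinct p" "set p \<subseteq> E"
  shows "\<bar>weight w p\<bar> \<le> (\<Sum>e\<in>E. \<bar>w e\<bar>)"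
proof -
  have "weight w p = (\<Sum>e\<in>set p. w e)"
    using assms(2) by (simp add: weight_def sum_list_distinct_conv_sum_set)
  also have "\<bar>\<dots>\<bar> \<le> (\<Sum>e\<in>set p. \<bar>w e\<bar>)"
    by (rule sum_abs)
  also have "\<dots> \<le> (\<Sum>e\<in>E. \<bar>w e\<bar>)"
    using assms by (intro sum_mono2) auto
  finally show ?thesis .
qed

text \<open>This certifies lower bounds for all walks at once: if \<open>g\<close> is nonnegative,
  none of them weighs less than \<open>- g u\<close>.\<close>

lemma walk_potential:
  assumes "walk E u p v"
    and "\<And>x y. (x, y) \<in> E \<Longrightarrow> g y \<le> g x + w (x, y)"
  shows "g v \<le> g u + weight w p"
  using assms(1)
proof (induction p arbitrary: u)
  case (Cons e p)
  then have "walk E (snd e) p v" "(fst e, snd e) \<in> E" "e = (u, snd e)"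
    by auto
  then show ?case
    using Cons.IH[of "snd e"] assms(2)[of "fst e" "snd e"]
    by (cases e) simp
qed simp


section \<open>Minimal energies in terms of walks\<close>

text \<open>Without a reachable negative cycle the lightest walks are simple, and a reachable
  negative cycle can be repeated until any bound fails. Comparison with finite bounds thus merges
  the two cases of \<open>play_energy\<close>.\<close>

lemma play_energy_le_iff:
  assumes "pair_fin_digraph H" "s \<in> pverts H"
  shows "play_energy H w s \<le> enat n \<longleftrightarrow> (\<forall>p v. walk (parcs H) s p v \<longrightarrow> - int n \<le> weight w p)"
proof -
  interpret pair_fin_digraph H by fact
  let ?W = "{weight w P | P. \<exists>v. pre_digraph.apath (with_proj H) s P v}"
  have apath: "pre_digraph.apath (with_proj H) s p v \<longleftrightarrow>
      walk (parcs H) s p v \<and> distinct (map fst p @ [v])" for p v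
    unfolding pre_digraph.apath_def awalk_with_proj_iff awalk_verts_with_proj_eq
    using assms(2) pawalk_verts_walk by metis
  have "?W \<subseteq> weight w ` {p. set p \<subseteq> parcs H \<and> distinct p}"
    by (auto simp: apath walk_def distinct_map)
  then have fin: "finite ?W"
    by (rule finite_subset) (simp add: finite_subset_distinct)
  have "pre_digraph.apath (with_proj H) s [] s"
    by (simp add: apath)
  then have ne: "?W \<noteq> {}"
    by blast
  define neg where "neg \<longleftrightarrow>
    (\<exists>C. pre_digraph.cycle (with_proj H) C \<and> s \<rightarrow>\<^sup>*\<^bsub>with_proj H\<^esub> fst (hd C) \<and> weight w C < 0)"
  have reach: "s \<rightarrow>\<^sup>*\<^bsub>with_proj H\<^esub> a \<longleftrightarrow> (\<exists>q. walk (parcs H) s q a)" for a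
    using assms(2) by (simp add: reachable_awalk awalk_with_proj_iff)
  have le: "play_energy H w s \<le> enat n \<longleftrightarrow>
      \<not> neg \<and> (\<forall>p v. pre_digraph.apath (with_proj H) s p v \<longrightarrow> - int n \<le> weight w p)"
  proof -
    have "nat (max 0 (- Min ?W)) \<le> n \<longleftrightarrow> - int n \<le> Min ?W"
      by linarith
    also have "\<dots> \<longleftrightarrow> (\<forall>p v. pre_digraph.apath (with_proj H) s p v \<longrightarrow> - int n \<le> weight w p)"
      using Min_ge_iff[OF fin ne] by blast
    moreover have "play_energy H w s = (if neg then \<infinity> else enat (nat (max 0 (- Min ?W))))"
      by (simp only: play_energy_def neg_def)
    ultimately show ?thesis
      by simp
  qed
  show ?thesis
  proof
    assume "play_energy H w s \<le> enat n"
    then have "\<not> neg" and simple: "\<And>p v. walk (parcs H) s p v \<Longrightarrow> distinct (map fst p @ [v]) \<Longrightarrow>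
        - int n \<le> weight w p"
      by (auto simp: le apath)
    have "0 \<le> weight w c" if c: "walk (parcs H) s q a" "walk (parcs H) a c a" "c \<noteq> []"
      "distinct (map fst (q @ c))" for q c a
    proof -
      have hd: "fst (hd c) = a"
        using c by (cases c) auto
      have "a \<in> pverts H"
        using c(2,3) wellformed' by (cases c) force+
      \<comment> \<open>The vertex list of the closed walk has \<open>a\<close> at both ends;
        \<open>tl\<close> drops the first occurrence.\<close>
      moreover have "distinct (tl (map fst c @ [a]))"
        using c hd by (cases c) auto
      ultimately have "pre_digraph.cycle (with_proj H) c"
        unfolding pre_digraph.cycle_def using c
        by (auto simp: awalk_with_proj_iff awalk_verts_with_proj_eq pawalk_verts_walk)
      with \<open>\<not> neg\<close> show ?thesis
        unfolding neg_def reach hd using c(1) hd by fastforce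
    qed
    with simple show "\<forall>p v. walk (parcs H) s p v \<longrightarrow> - int n \<le> weight w p"
      by (intro allI impI) (rule walk_weight_ge)
  next
    assume *: "\<forall>p v. walk (parcs H) s p v \<longrightarrow> - int n \<le> weight w p"
    have "\<not> neg"
    proof
      assume neg
      then obtain C q u where C: "walk (parcs H) s q (fst (hd C))" "walk (parcs H) u C u" "C \<noteq> []"
        "weight w C < 0"
        unfolding neg_def by (auto simp: pre_digraph.cycle_def awalk_with_proj_iff reach)
      then have "fst (hd C) = u"
        by (cases C) auto
      with walk_pump[of "parcs H" s q u C w "- int n"] C * show False
        by (metis not_le)
    qed
    with * show "play_energy H w s \<le> enat n"
      by (auto simp: le apath)
  qed
qed

text \<open>Only Alice is bound to a strategy here: along these arcs Bob may move differently at
  each visit of a vertex.\<close>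

definition alice_arcs :: "'v game_graph \<Rightarrow> ('v \<Rightarrow> 'v) \<Rightarrow> ('v \<times> 'v) set" where
  "alice_arcs G \<sigma> = {(u, v) \<in> parcs (arena G). u \<in> alice G \<longrightarrow> v = \<sigma> u}"

lemma game_graph_out_neighbor:
  assumes "game_graph G" "u \<in> pverts (arena G)"
  shows "\<exists>v. (u, v) \<in> parcs (arena G)"
proof -
  have "card (out_arcs (with_proj (arena G)) u) \<noteq> 0"
    using assms by (auto simp: game_graph_def out_degree_def)
  then have "out_arcs (with_proj (arena G)) u \<noteq> {}"
    by force
  then show ?thesis
    by (auto simp: out_arcs_def)
qed

lemma game_graphI:
  assumes "finite (pverts (arena G))" "parcs (arena G) \<subseteq> pverts (arena G) \<times> pverts (arena G)"
    "alice G \<union> bob G = pverts (arena G)" "alice G \<inter> bob G = {}"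
    "\<And>u. u \<in> pverts (arena G) \<Longrightarrow> \<exists>v. (u, v) \<in> parcs (arena G)"
  shows "game_graph G"
proof -
  have fin: "finite (parcs (arena G))"
    using assms(1,2) by (meson finite_SigmaI finite_subset)
  have "1 \<le> out_degree (with_proj (arena G)) u" if "u \<in> pverts (arena G)" for u
  proof -
    have "out_arcs (with_proj (arena G)) u \<noteq> {}" "finite (out_arcs (with_proj (arena G)) u)"
      using assms(5)[OF that] fin by (auto simp: out_arcs_def)
    then have "card (out_arcs (with_proj (arena G)) u) \<noteq> 0"
      by simp
    then show ?thesis
      by (simp add: out_degree_def)
  qed
  then show ?thesis
    using assms fin by (auto simp: game_graph_def intro!: pair_fin_digraph.intro
        pair_wf_digraph.intro pair_fin_digraph_axioms.intro)
qed

lemma game_graph_simps: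
  assumes "game_graph G"
  shows "finite (parcs (arena G))" "finite (alice G)" "finite (bob G)"
    "finite (pverts (arena G))" "pverts (arena G) = alice G \<union> bob G" "alice G \<inter> bob G = {}"
    "(u, v) \<in> parcs (arena G) \<Longrightarrow> u \<in> pverts (arena G)"
    "(u, v) \<in> parcs (arena G) \<Longrightarrow> v \<in> pverts (arena G)"
proof -
  interpret pair_fin_digraph "arena G"
    using assms by (simp add: game_graph_def)
  show "finite (parcs (arena G))" "finite (pverts (arena G))"
    by (rule pair_finite_arcs pair_finite_verts)+
  show eq: "pverts (arena G) = alice G \<union> bob G" "alice G \<inter> bob G = {}"
    using assms by (auto simp: game_graph_def)
  then show "finite (alice G)" "finite (bob G)"
    using pair_finite_verts by auto
  show "(u, v) \<in> parcs (arena G) \<Longrightarrow> u \<in> pverts (arena G)"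
    "(u, v) \<in> parcs (arena G) \<Longrightarrow> v \<in> pverts (arena G)"
    using wellformed' by auto
qed

lemma finite_out_neighbors:
  assumes "game_graph G"
  shows "finite (out_neighbors (arena G) u)"
proof (rule finite_subset)
  show "out_neighbors (arena G) u \<subseteq> snd ` parcs (arena G)"
    by (force simp: out_neighbors_def)
qed (simp add: game_graph_simps(1)[OF assms])

lemma strategies_finite_nonempty:
  assumes "game_graph G"
  shows "finite (alice_strategies G)" "alice_strategies G \<noteq> {}"
    "finite (bob_strategies G)" "bob_strategies G \<noteq> {}"
  using game_graph_out_neighbor[OF assms]
  by (auto simp: alice_strategies_def bob_strategies_def PiE_eq_empty_iff game_graph_simps[OF assms]
      out_neighbors_def intro!: finite_PiE finite_out_neighbors[OF assms])

lemma play_graph_arcs_subset: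
  assumes "\<sigma> \<in> alice_strategies G" "\<tau> \<in> bob_strategies G" "alice G \<inter> bob G = {}"
  shows "parcs (play_graph G \<sigma> \<tau>) \<subseteq> alice_arcs G \<sigma>"
  using assms
  by (auto simp: play_graph_def alice_arcs_def alice_strategies_def bob_strategies_def
      out_neighbors_def)

lemma pair_fin_digraph_play_graph:
  assumes "game_graph G" "\<sigma> \<in> alice_strategies G" "\<tau> \<in> bob_strategies G"
  shows "pair_fin_digraph (play_graph G \<sigma> \<tau>)"
proof -
  note * = game_graph_simps[OF assms(1)]
  have sub: "parcs (play_graph G \<sigma> \<tau>) \<subseteq> parcs (arena G)"
    using play_graph_arcs_subset[OF assms(2,3) *(6)] by (auto simp: alice_arcs_def)
  have "fst e \<in> pverts (arena G) \<and> snd e \<in> pverts (arena G)"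
    if "e \<in> parcs (play_graph G \<sigma> \<tau>)" for e
    using that sub *(7,8)[of "fst e" "snd e"] by auto
  moreover have "pverts (play_graph G \<sigma> \<tau>) = pverts (arena G)"
    by (simp add: play_graph_def)
  ultimately show ?thesis
    using *(4) finite_subset[OF sub *(1)] by unfold_locales auto
qed

text \<open>A walk that leaves no vertex twice is itself a partial positional strategy. Its end may
  be a vertex left before, which admits lassos.\<close>

lemma walk_consistent_with_bob_strategy:
  assumes "game_graph G" "walk (alice_arcs G \<sigma>) s p v" "distinct (map fst p)"
  shows "\<exists>\<tau>\<in>bob_strategies G. walk (parcs (play_graph G \<sigma> \<tau>)) s p v"
proof -
  \<comment> \<open>\<open>map_of p\<close> yields the successor of each vertex that
    \<open>p\<close> leaves; at the other vertices Bob moves arbitrarily.\<close>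
  define \<tau> where "\<tau> = restrict (\<lambda>u. case map_of p u of Some y \<Rightarrow> y |
      None \<Rightarrow> (SOME y. (u, y) \<in> parcs (arena G))) (bob G)"
  have sub: "set p \<subseteq> alice_arcs G \<sigma>"
    using assms(2) by (simp add: walk_def)
  have "(u, \<tau> u) \<in> parcs (arena G)" if "u \<in> bob G" for u
  proof (cases "map_of p u")
    case None
    have "(u, SOME y. (u, y) \<in> parcs (arena G)) \<in> parcs (arena G)"
      by (rule someI_ex, rule game_graph_out_neighbor)
        (use assms(1) that game_graph_simps(5) in auto)
    with None that show ?thesis
      by (simp add: \<tau>_def)
  next
    case (Some y)
    then have "(u, y) \<in> set p"
      by (rule map_of_SomeD)
    with sub Some that show ?thesis
      by (auto simp: \<tau>_def alice_arcs_def)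
  qed
  then have "\<tau> \<in> bob_strategies G"
    unfolding bob_strategies_def by (auto simp: out_neighbors_def \<tau>_def)
  moreover have "(x, y) \<in> parcs (play_graph G \<sigma> \<tau>)" if xy: "(x, y) \<in> set p" for x y
  proof -
    have m: "map_of p x = Some y"
      using xy assms(3) by simp
    have "(x, y) \<in> alice_arcs G \<sigma>"
      using sub xy by auto
    then show ?thesis
      using m game_graph_simps(5,7)[OF assms(1)]
      by (auto simp: play_graph_def alice_arcs_def \<tau>_def)
  qed
  ultimately show ?thesis
    using assms(2) unfolding walk_def by (intro bexI[of _ \<tau>]) auto
qed

text \<open>If some walk is too light, then so is a simple walk, or there is a lasso with a negative
  cycle. Bob can follow either of them positionally, so his maximum over positional strategies
  amounts to all walks.\<close>

lemma min_energy_le_iff: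
  assumes "game_graph G" "s \<in> pverts (arena G)"
  shows "min_energy G w s \<le> enat n \<longleftrightarrow>
    (\<exists>\<sigma>\<in>alice_strategies G. \<forall>p v. walk (alice_arcs G \<sigma>) s p v \<longrightarrow> - int n \<le> weight w p)"
proof -
  note fin = strategies_finite_nonempty[OF assms(1)]
  have s: "s \<in> pverts (play_graph G \<sigma> \<tau>)" for \<sigma> \<tau>
    using assms(2) by (simp add: play_graph_def)
  have "min_energy G w s \<le> enat n \<longleftrightarrow> (\<exists>\<sigma>\<in>alice_strategies G. \<forall>\<tau>\<in>bob_strategies G.
      play_energy (play_graph G \<sigma> \<tau>) w s \<le> enat n)"
    unfolding min_energy_def using fin by (subst Min_le_iff) auto
  also have "\<dots> \<longleftrightarrow> (\<exists>\<sigma>\<in>alice_strategies G. \<forall>\<tau>\<in>bob_strategies G.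
      \<forall>p v. walk (parcs (play_graph G \<sigma> \<tau>)) s p v \<longrightarrow> - int n \<le> weight w p)"
    by (intro bex_cong ball_cong refl play_energy_le_iff s pair_fin_digraph_play_graph assms(1))
  also have "\<dots> \<longleftrightarrow>
      (\<exists>\<sigma>\<in>alice_strategies G. \<forall>p v. walk (alice_arcs G \<sigma>) s p v \<longrightarrow> - int n \<le> weight w p)"
  proof (intro bex_cong refl)
    fix \<sigma> assume \<sigma>: "\<sigma> \<in> alice_strategies G"
    show "(\<forall>\<tau>\<in>bob_strategies G. \<forall>p v. walk (parcs (play_graph G \<sigma> \<tau>)) s p v \<longrightarrow>
        - int n \<le> weight w p) \<longleftrightarrow> (\<forall>p v. walk (alice_arcs G \<sigma>) s p v \<longrightarrow> - int n \<le> weight w p)"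
      (is "?L \<longleftrightarrow> ?R")
    proof
      assume L: ?L
      have simple: "- int n \<le> weight w p"
        if p: "walk (alice_arcs G \<sigma>) s p v" "distinct (map fst p @ [v])" for p v
      proof -
        have "distinct (map fst p)"
          using p(2) by simp
        from walk_consistent_with_bob_strategy[OF assms(1) p(1) this] L show ?thesis
          by blast
      qed
      have lasso: "0 \<le> weight w c" if "walk (alice_arcs G \<sigma>) s q a" "walk (alice_arcs G \<sigma>) a c a"
        "c \<noteq> []" "distinct (map fst (q @ c))" for q c a
      proof (rule ccontr)
        assume neg: "\<not> 0 \<le> weight w c"
        have "walk (alice_arcs G \<sigma>) s (q @ c) a"
          using that by auto
        from walk_consistent_with_bob_strategy[OF assms(1) this that(4)] obtain \<tau> where
          \<tau>: "\<tau> \<in> bob_strategies G" "walk (parcs (play_graph G \<sigma> \<tau>)) s (q @ c) a"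
          by blast
        have "pcas s q a" "pcas a c a"
          using that by (simp_all add: walk_def)
        with \<tau> have "walk (parcs (play_graph G \<sigma> \<tau>)) s q a" "walk (parcs (play_graph G \<sigma> \<tau>)) a c a"
          by (auto simp: walk_def)
        from walk_pump[OF this, of w "- int n"] neg L \<tau>(1) show False
          by (meson not_le)
      qed
      show ?R
      proof (intro allI impI)
        fix p v assume "walk (alice_arcs G \<sigma>) s p v"
        with simple lasso show "- int n \<le> weight w p"
          by (rule walk_weight_ge)
      qed
    next
      assume R: ?R
      show ?L
      proof (intro ballI allI impI)
        fix \<tau> p v assume "\<tau> \<in> bob_strategies G" "walk (parcs (play_graph G \<sigma> \<tau>)) s p v"
        then have "walk (alice_arcs G \<sigma>) s p v"
          using play_graph_arcs_subset[OF \<sigma> _ game_graph_simps(6)[OF assms(1)]]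
          by (blast intro: walk_mono)
        with R show "- int n \<le> weight w p"
          by blast
      qed
    qed
  qed
  finally show ?thesis .
qed

lemma enat_eqI:
  fixes x y :: enat
  assumes "\<And>n. x \<le> enat n \<longleftrightarrow> y \<le> enat n"
  shows "x = y"
  by (metis assms antisym enat_ile enat_ord_code(3) not_infinity_eq order_refl)

text \<open>An encoded instance fixes the weights on the arcs only; by this lemma its answer does
  not depend on the other values of \<open>w\<close>.\<close>

lemma min_energy_cong:
  assumes "game_graph G" "s \<in> pverts (arena G)" "\<And>e. e \<in> parcs (arena G) \<Longrightarrow> w e = w' e"
  shows "min_energy G w s = min_energy G w' s"
proof (rule enat_eqI)
  fix n
  have "weight w p = weight w' p" if "walk (alice_arcs G \<sigma>) s p v" for \<sigma> p v
    unfolding weight_def using that assms(3)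
    by (intro arg_cong[where f = sum_list] map_cong) (auto simp: walk_def alice_arcs_def)
  then show "min_energy G w s \<le> enat n \<longleftrightarrow> min_energy G w' s \<le> enat n"
    unfolding min_energy_le_iff[OF assms(1,2)] by (simp cong: imp_cong)
qed

section \<open>The total weight as a bound on finite minimal energies\<close>

definition total_weight :: "'v game_graph \<Rightarrow> ('v \<times> 'v \<Rightarrow> int) \<Rightarrow> int" where
  "total_weight G w = (\<Sum>e\<in>parcs (arena G). \<bar>w e\<bar>)"

lemma total_weight_nonneg: "0 \<le> total_weight G w"
  by (simp add: total_weight_def sum_nonneg)

lemma abs_weight_le_total_weight:
  assumes "game_graph G" "set p \<subseteq> parcs (arena G)" "distinct (map fst p)"
  shows "\<bar>weight w p\<bar> \<le> total_weight G w"
  unfolding total_weight_def using assms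
  by (intro abs_weight_le) (auto simp: game_graph_simps distinct_map)

text \<open>A strategy that guarantees any finite bound admits no reachable negative cycle. Hence
  its lightest walks are simple, and these use each arc at most once.\<close>

lemma finite_min_energy_le_total_weight:
  assumes "game_graph G" "s \<in> pverts (arena G)" "min_energy G w s \<noteq> \<infinity>"
  shows "min_energy G w s \<le> enat (nat (total_weight G w))"
proof -
  obtain n where "min_energy G w s \<le> enat n"
    using assms(3) by (metis enat_ord_simps(1) not_infinity_eq order_refl)
  then obtain \<sigma> where \<sigma>: "\<sigma> \<in> alice_strategies G"
    "\<And>p v. walk (alice_arcs G \<sigma>) s p v \<Longrightarrow> - int n \<le> weight w p"
    unfolding min_energy_le_iff[OF assms(1,2)] by blast
  have arcs: "walk (alice_arcs G \<sigma>) u p v \<Longrightarrow> set p \<subseteq> parcs (arena G)" for u p v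
    by (auto simp: walk_def alice_arcs_def)
  have "- total_weight G w \<le> weight w p" if "walk (alice_arcs G \<sigma>) s p v" for p v
  proof (rule walk_weight_ge[OF _ _ that])
    fix p v assume "walk (alice_arcs G \<sigma>) s p v" "distinct (map fst p @ [v])"
    then show "- total_weight G w \<le> weight w p"
      using abs_weight_le_total_weight[OF assms(1) arcs, of s p v w] by auto
  next
    fix q c a assume "walk (alice_arcs G \<sigma>) s q a" "walk (alice_arcs G \<sigma>) a c a"
    then show "0 \<le> weight w c"
      using walk_pump[of "alice_arcs G \<sigma>" s q a c w "- int n"] \<sigma>(2) by (meson not_le)
  qed
  then show ?thesis
    unfolding min_energy_le_iff[OF assms(1,2)] using \<sigma>(1) total_weight_nonneg[of G w] by auto
qed


section \<open>The biclique game\<close>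

text \<open>Every vertex \<open>u\<close> has the copies \<open>2 * u\<close> of Alice and \<open>2 * u + 1\<close> of Bob. The copy of
  the owner of \<open>u\<close> moves as \<open>u\<close> does, the other copy passes the turn to it. All the other
  arcs are too expensive for the player who could use them; those of Bob are compensated even for
  an expensive arc used by Alice before.\<close>

definition biclique :: "nat game_graph \<Rightarrow> nat game_graph" where
  "biclique G = (let V = pverts (arena G); A = (\<lambda>u. 2 * u) ` V; B = (\<lambda>u. 2 * u + 1) ` V in
     \<lparr> arena = \<lparr> pverts = A \<union> B, parcs = A \<times> B \<union> B \<times> A \<rparr>, alice = A, bob = B \<rparr>)"

text \<open>The target is given by its original vertex \<open>v\<close>, as its side is always the
  opposite one; \<open>u = v\<close> then means passing the turn. \<open>d\<close> is the
  penalty.\<close>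

definition move_weight ::
    "nat game_graph \<Rightarrow> (nat \<times> nat \<Rightarrow> int) \<Rightarrow> bool \<Rightarrow> nat \<Rightarrow> nat \<Rightarrow> int \<Rightarrow> int" where
  "move_weight G w own u v d =
     (if own then if (u, v) \<in> parcs (arena G) then w (u, v) else d else if u = v then 0 else d)"

text \<open>A walk that leaves no vertex twice earns at most \<open>total_weight G w\<close>; with
  this penalty it falls below \<open>- total_weight G w\<close> and so violates every bound that has
  to be compared.\<close>

definition alice_penalty :: "nat game_graph \<Rightarrow> (nat \<times> nat \<Rightarrow> int) \<Rightarrow> int" where
  "alice_penalty G w = 2 * total_weight G w + 1"

text \<open>This is \<open>alice_penalty G w + 2 * total_weight G w\<close>: it pays for Alice's
  penalized return to the start and leaves her the largest credit that is in use at the vertices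
  reachable under her strategy.\<close>

definition bob_penalty :: "nat game_graph \<Rightarrow> (nat \<times> nat \<Rightarrow> int) \<Rightarrow> int" where
  "bob_penalty G w = 4 * total_weight G w + 1"

definition biclique_weight :: "nat game_graph \<Rightarrow> (nat \<times> nat \<Rightarrow> int) \<Rightarrow> nat \<times> nat \<Rightarrow> int" where
  "biclique_weight G w = (\<lambda>(x, y).
     if even x then move_weight G w (x div 2 \<in> alice G) (x div 2) (y div 2) (- alice_penalty G w)
     else move_weight G w (x div 2 \<notin> alice G) (x div 2) (y div 2) (bob_penalty G w))"

lemma biclique_simps:
  "pverts (arena (biclique G)) = (\<lambda>u. 2 * u) ` pverts (arena G) \<union> (\<lambda>u. 2 * u + 1) ` pverts (arena G)"
  "alice (biclique G) = (\<lambda>u. 2 * u) ` pverts (arena G)"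
  "bob (biclique G) = (\<lambda>u. 2 * u + 1) ` pverts (arena G)"
  "parcs (arena (biclique G)) = alice (biclique G) \<times> bob (biclique G) \<union>
     bob (biclique G) \<times> alice (biclique G)"
  by (simp_all add: biclique_def Let_def)

lemma even_odd_disjoint: "(\<lambda>u::nat. 2 * u) ` V \<inter> (\<lambda>u. 2 * u + 1) ` V = {}"
  by (auto, presburger)

lemma game_graph_biclique:
  assumes "game_graph G"
  shows "game_graph (biclique G)"
proof (rule game_graphI)
  show "alice (biclique G) \<inter> bob (biclique G) = {}"
    by (simp only: biclique_simps even_odd_disjoint)
qed (auto simp: biclique_simps game_graph_simps(4)[OF assms])

text \<open>Two vertices of \<open>S\<close> with different owners stay adjacent in the induced
  game, so the argument is the same for all subgraphs.\<close>

lemma strongly_ergodic_biclique: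
  assumes "game_graph G"
  shows "strongly_ergodic (biclique G)"
  unfolding strongly_ergodic_def ergodic_def
proof (intro allI impI)
  fix S S\<^sub>A S\<^sub>B
  let ?H = "biclique G"
  assume "S \<subseteq> pverts (arena ?H)" and part: "ergodic_partition (induced_game ?H S) S\<^sub>A S\<^sub>B"
  then have S: "S\<^sub>A \<union> S\<^sub>B = S" "S \<subseteq> alice ?H \<union> bob ?H"
    by (auto simp: ergodic_partition_def induced_game_def biclique_simps(1-3))
  have part_A: "\<forall>u\<in>S\<^sub>A \<inter> (alice ?H \<inter> S). \<exists>v\<in>S\<^sub>A. (u, v) \<in> parcs (arena ?H) \<inter> S \<times> S"
    and part_AB: "\<forall>u\<in>S\<^sub>A \<inter> (bob ?H \<inter> S). \<forall>v\<in>S\<^sub>B. (u, v) \<notin> parcs (arena ?H) \<inter> S \<times> S"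
    and part_B: "\<forall>u\<in>S\<^sub>B \<inter> (bob ?H \<inter> S). \<exists>v\<in>S\<^sub>B. (u, v) \<in> parcs (arena ?H) \<inter> S \<times> S"
    using part unfolding ergodic_partition_def induced_game_def game_graph.simps
      pair_pre_digraph.simps by - (elim conjE, assumption)+
  have disj: "alice ?H \<inter> bob ?H = {}"
    by (rule game_graph_simps(6)[OF game_graph_biclique[OF assms]])
  have arc_iff: "(u, v) \<in> parcs (arena ?H) \<longleftrightarrow>
      u \<in> alice ?H \<and> v \<in> bob ?H \<or> u \<in> bob ?H \<and> v \<in> alice ?H" for u v
    by (auto simp: biclique_simps(4))
  have A: "\<exists>v\<in>S\<^sub>A. v \<in> bob ?H" if u: "u \<in> S\<^sub>A" "u \<in> alice ?H" for u
  proof -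
    obtain v where "v \<in> S\<^sub>A" "(u, v) \<in> parcs (arena ?H)"
      using part_A u S(1) by blast
    then show ?thesis
      using u disj arc_iff by blast
  qed
  have B: "\<exists>v\<in>S\<^sub>B. v \<in> alice ?H" if u: "u \<in> S\<^sub>B" "u \<in> bob ?H" for u
  proof -
    obtain v where "v \<in> S\<^sub>B" "(u, v) \<in> parcs (arena ?H)"
      using part_B u S(1) by blast
    then show ?thesis
      using u disj arc_iff by blast
  qed
  have AB: "v \<notin> alice ?H" if "u \<in> S\<^sub>A" "u \<in> bob ?H" "v \<in> S\<^sub>B" for u v
  proof -
    have "(u, v) \<notin> parcs (arena ?H)"
      using part_AB that S(1) by blast
    then show ?thesis
      using that arc_iff by blast
  qed
  show "S\<^sub>A = {} \<or> S\<^sub>B = {}"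
  proof (rule ccontr)
    assume "\<not> (S\<^sub>A = {} \<or> S\<^sub>B = {})"
    then obtain x y where "x \<in> S\<^sub>A" "y \<in> S\<^sub>B"
      by blast
    moreover from this have "x \<in> alice ?H \<union> bob ?H" "y \<in> alice ?H \<union> bob ?H"
      using S by auto
    \<comment> \<open>All arcs change sides, so if \<open>x\<close> or \<open>y\<close> has the
      wrong owner, the out-neighbor that it must have in its part has the right one.\<close>
    ultimately obtain x' y' where "x' \<in> S\<^sub>A" "x' \<in> bob ?H" "y' \<in> S\<^sub>B" "y' \<in> alice ?H"
      using A[of x] B[of y] by blast
    with AB show False
      by blast
  qed
qed

lemma cw_constructible_discrete:
  assumes "finite X" "i < k"
  shows "\<exists>l. cw_constructible k X {} l \<and> (\<forall>v\<in>X. l v = i)"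
  using assms(1)
proof induction
  case empty
  show ?case
    by (auto intro: cw_empty)
next
  case (insert x X)
  then obtain l where "cw_constructible k X {} l" "\<forall>v\<in>X. l v = i"
    by blast
  with cw_union[OF cw_node[OF assms(2), of x] this(1)] insert.hyps(2) show ?case
    by (intro exI) auto
qed

text \<open>One label per side; two arc operations, one for each direction, create all arcs.\<close>

lemma clique_width_biclique:
  assumes "game_graph G"
  shows "clique_width (arena (biclique G)) \<le> 2"
proof -
  let ?H = "biclique G"
  note * = game_graph_simps[OF game_graph_biclique[OF assms]]
  obtain l\<^sub>A where A: "cw_constructible 2 (alice ?H) {} l\<^sub>A" "\<forall>v\<in>alice ?H. l\<^sub>A v = 0"
    using cw_constructible_discrete[OF *(2), of 0 2] by auto
  obtain l\<^sub>B where B: "cw_constructible 2 (bob ?H) {} l\<^sub>B" "\<forall>v\<in>bob ?H. l\<^sub>B v = 1"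
    using cw_constructible_discrete[OF *(3), of 1 2] by auto
  define l where "l = (\<lambda>v. if v \<in> alice ?H then l\<^sub>A v else l\<^sub>B v)"
  let ?V = "alice ?H \<union> bob ?H"
  have l: "v \<in> ?V \<Longrightarrow> l v = (if v \<in> alice ?H then 0 else 1)" for v
    using A(2) B(2) by (auto simp: l_def)
  have "cw_constructible 2 ?V ({} \<union> {}) l"
    unfolding l_def by (rule cw_union[OF A(1) B(1) *(6)])
  then have "cw_constructible 2 ?V (({} \<union> {} \<union> {(u, v). u \<in> ?V \<and> v \<in> ?V \<and> l u = 0 \<and> l v = 1})
      \<union> {(u, v). u \<in> ?V \<and> v \<in> ?V \<and> l u = 1 \<and> l v = 0}) l"
    by (intro cw_arcs) auto
  also have "({} \<union> {} \<union> {(u, v). u \<in> ?V \<and> v \<in> ?V \<and> l u = 0 \<and> l v = 1})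
      \<union> {(u, v). u \<in> ?V \<and> v \<in> ?V \<and> l u = 1 \<and> l v = 0} = parcs (arena ?H)"
    using *(6) by (auto simp: biclique_simps(4) l disjoint_iff split: if_splits)
  finally show ?thesis
    unfolding clique_width_def *(5) by (intro Least_le exI)
qed


section \<open>Comparison of the minimal energies in a game and in its biclique\<close>

context
  fixes G :: "nat game_graph" and w :: "nat \<times> nat \<Rightarrow> int"
  assumes game: "game_graph G"
begin

private abbreviation (input) "H \<equiv> biclique G"
private abbreviation (input) "W \<equiv> biclique_weight G w"
private abbreviation (input) "S \<equiv> total_weight G w"

lemma abs_arc_weight_le: "e \<in> parcs (arena G) \<Longrightarrow> \<bar>w e\<bar> \<le> S"
  using abs_weight_le_total_weight[OF game, of "[e]" w] by simp

lemma alice_arcs_biclique_cases: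
  assumes "(x, y) \<in> alice_arcs H \<sigma>"
  obtains (alice) u v where "x = 2 * u" "y = 2 * v + 1" "\<sigma> x = y"
      "u \<in> pverts (arena G)" "v \<in> pverts (arena G)"
      "W (x, y) = move_weight G w (u \<in> alice G) u v (- alice_penalty G w)"
  | (bob) u v where "x = 2 * u + 1" "y = 2 * v"
      "u \<in> pverts (arena G)" "v \<in> pverts (arena G)"
      "W (x, y) = move_weight G w (u \<notin> alice G) u v (bob_penalty G w)"
proof -
  have "x \<in> alice H \<and> y \<in> bob H \<and> \<sigma> x = y \<or> x \<in> bob H \<and> y \<in> alice H"
    using assms by (auto simp: alice_arcs_def biclique_simps(4))
  then show thesis
    using that by (auto simp: biclique_simps(2,3) biclique_weight_def)
qed

text \<open>Alice imitates a strategy that witnesses \<open>n\<close> on the vertices reachable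
  under it and returns to \<open>s\<close> from everywhere else. The credit that she needs at each
  vertex is a nonnegative potential that is at most \<open>n\<close> at
  \<open>2 * s\<close>.\<close>

lemma min_energy_biclique_le:
  assumes s: "s \<in> pverts (arena G)" and n: "int n \<le> S" and le: "min_energy G w s \<le> enat n"
  shows "min_energy H W (2 * s) \<le> enat n"
proof -
  obtain \<sigma> where \<sigma>: "\<sigma> \<in> alice_strategies G"
    and ge: "\<And>p v. walk (alice_arcs G \<sigma>) s p v \<Longrightarrow> - int n \<le> weight w p"
    using le unfolding min_energy_le_iff[OF game s] by blast
  define R where "R = {v. \<exists>p. walk (alice_arcs G \<sigma>) s p v}"
  \<comment> \<open>The least credit left on arrival at \<open>v\<close> after a start at
    \<open>s\<close> with credit \<open>n\<close>. It is a natural number because no walk weighs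
    less than \<open>- int n\<close>.\<close>
  define level where
    "level v = (LEAST k. \<exists>p. walk (alice_arcs G \<sigma>) s p v \<and> int k = int n + weight w p)" for v
  have level_le: "int (level v) \<le> int n + weight w p" if p: "walk (alice_arcs G \<sigma>) s p v" for v p
  proof -
    have "level v \<le> nat (int n + weight w p)"
      unfolding level_def by (rule Least_le) (use p ge[OF p] in auto)
    with ge[OF p] show ?thesis
      by linarith
  qed
  have level_attained: "\<exists>p. walk (alice_arcs G \<sigma>) s p v \<and> int (level v) = int n + weight w p"
    if v: "v \<in> R" for v
  proof -
    obtain p where p: "walk (alice_arcs G \<sigma>) s p v"
      using v by (auto simp: R_def)
    show ?thesis
      unfolding level_def by (rule LeastI[of _ "nat (int n + weight w p)"])
        (use p ge[OF p] in auto)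
  qed
  have R_step: "v \<in> R \<and> int (level v) \<le> int (level u) + w (u, v)"
    if "u \<in> R" "(u, v) \<in> alice_arcs G \<sigma>" for u v
  proof -
    obtain p where p: "walk (alice_arcs G \<sigma>) s p u" "int (level u) = int n + weight w p"
      using level_attained[OF \<open>u \<in> R\<close>] by blast
    then have uv: "walk (alice_arcs G \<sigma>) s (p @ [(u, v)]) v"
      using that by simp
    then have "v \<in> R"
      unfolding R_def by blast
    moreover have "int (level v) \<le> int n + (weight w p + w (u, v))"
      using level_le[OF uv] by simp
    ultimately show ?thesis
      unfolding p(2) by linarith
  qed
  \<comment> \<open>The least credit is bounded along a walk that leaves no vertex twice: start
    credit and gain are at most \<open>S\<close> each.\<close>
  have level_bound: "int (level v) \<le> 2 * S" if "v \<in> R" for v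
  proof -
    obtain p\<^sub>0 where "walk (alice_arcs G \<sigma>) s p\<^sub>0 v"
      using level_attained[OF \<open>v \<in> R\<close>] by blast
    from walk_imp_simple_walk[OF this] obtain p where
      p: "walk (alice_arcs G \<sigma>) s p v" "distinct (map fst p)"
      by blast
    then have "set p \<subseteq> parcs (arena G)"
      by (auto simp: walk_def alice_arcs_def)
    from abs_weight_le_total_weight[OF game this p(2), of w] have "weight w p \<le> S"
      by linarith
    with level_le[OF p(1)] n show ?thesis
      by simp
  qed
  have sR: "s \<in> R"
    unfolding R_def by (auto intro: exI[of _ "[]"])
  have level_s: "int (level s) \<le> int n"
    using level_le[of "[]" s] by simp
  note S0 = total_weight_nonneg[of G w]
  \<comment> \<open>At the vertices outside \<open>R\<close> Alice returns to \<open>s\<close>, where \<open>2 * S\<close> suffices, at the price of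
    one penalty; Bob may make one original move before.\<close>
  define g where "g x = (if x div 2 \<in> R then int (level (x div 2))
    else if even x then 2 * S + alice_penalty G w else 3 * S + alice_penalty G w)" for x
  define \<sigma>' where "\<sigma>' = restrict (\<lambda>x. if x div 2 \<in> R
    then if x div 2 \<in> alice G then 2 * \<sigma> (x div 2) + 1 else x + 1 else 2 * s + 1) (alice H)"
  have \<sigma>_arc: "(u, \<sigma> u) \<in> alice_arcs G \<sigma>" if "u \<in> alice G" for u
    using \<sigma> that by (auto simp: alice_strategies_def alice_arcs_def out_neighbors_def)
  have "\<sigma> u \<in> pverts (arena G)" if "u \<in> alice G" for u
    using \<sigma>_arc[OF that] game_graph_simps(8)[OF game] by (auto simp: alice_arcs_def)
  then have \<sigma>': "\<sigma>' \<in> alice_strategies H"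
    using s by (auto simp: alice_strategies_def \<sigma>'_def out_neighbors_def biclique_simps)
  have g_nonneg: "0 \<le> g x" for x
    using S0 by (simp add: g_def alice_penalty_def)
  \<comment> \<open>The value at Alice's copies outside \<open>R\<close>. It equals
    \<open>bob_penalty G w\<close>, so a penalized arc of Bob may lead to any of her copies.\<close>
  have g_le: "g (2 * v) \<le> 4 * S + 1" for v
    using level_bound[of v] S0 by (auto simp: g_def alice_penalty_def)
  have g_step: "g y \<le> g x + W (x, y)" if "(x, y) \<in> alice_arcs H \<sigma>'" for x y
    using that
  proof (cases rule: alice_arcs_biclique_cases)
    case (alice u v)
    have x: "x \<in> alice H"
      using alice by (simp add: biclique_simps)
    show ?thesis
    proof (cases "u \<in> R")
      case True
      show ?thesis
      proof (cases "u \<in> alice G")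
        case owner: True
        then have "v = \<sigma> u"
          using alice x True by (simp add: \<sigma>'_def)
        moreover have "(u, \<sigma> u) \<in> parcs (arena G)"
          using \<sigma>_arc[OF owner] by (simp add: alice_arcs_def)
        ultimately show ?thesis
          using alice True owner R_step[OF True \<sigma>_arc[OF owner]] by (simp add: g_def move_weight_def)
      next
        case False
        then have "v = u"
          using alice x True by (simp add: \<sigma>'_def)
        then show ?thesis
          using alice True False by (simp add: g_def move_weight_def)
      qed
    next
      case False
      then have v: "v = s"
        using alice x by (simp add: \<sigma>'_def)
      \<comment> \<open>The arc towards \<open>s\<close> may happen to be an original one, so its
        weight is only bounded from below.\<close>
      have "- alice_penalty G w \<le> W (x, y)"
        using alice(6) abs_arc_weight_le[of "(u, v)"] S0
        by (auto simp: move_weight_def alice_penalty_def)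
      then show ?thesis
        using alice False v sR level_s n S0 by (simp add: g_def)
    qed
  next
    case (bob u v)
    have far: ?thesis if "W (x, y) = bob_penalty G w"
      using that g_le[of v] g_nonneg[of x] bob by (simp add: bob_penalty_def)
    show ?thesis
    proof (cases "u \<in> alice G")
      case True
      then show ?thesis
        using bob far S0 by (cases "u = v") (auto simp: g_def move_weight_def)
    next
      case False
      show ?thesis
      proof (cases "(u, v) \<in> parcs (arena G)")
        case arc: True
        then have "W (x, y) = w (u, v)"
          using bob False by (simp add: move_weight_def)
        moreover have "(u, v) \<in> alice_arcs G \<sigma>"
          using arc False by (simp add: alice_arcs_def)
        \<comment> \<open>Outside \<open>R\<close> an original move of Bob costs at most
          \<open>S\<close>, which is the difference between \<open>3 * S\<close> and
          \<open>2 * S\<close> in \<open>g\<close>.\<close>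
        ultimately show ?thesis
          using bob R_step[of u v] abs_arc_weight_le[OF arc] g_le[of v]
          by (cases "u \<in> R") (auto simp: g_def alice_penalty_def)
      qed (use far bob False in \<open>simp add: move_weight_def\<close>)
    qed
  qed
  have "g (2 * s) \<le> int n"
    using sR level_s by (simp add: g_def)
  then have "- int n \<le> weight W p" if "walk (alice_arcs H \<sigma>') (2 * s) p v" for p v
    using walk_potential[where g = g and w = W, OF that g_step] g_nonneg[of v] by linarith
  moreover have "2 * s \<in> pverts (arena H)"
    using s by (simp add: biclique_simps(1))
  ultimately show ?thesis
    unfolding min_energy_le_iff[OF game_graph_biclique[OF game] \<open>2 * s \<in> pverts (arena H)\<close>]
    using \<sigma>' by blast
qed

definition owner_copy :: "nat \<Rightarrow> nat" where
  "owner_copy u = (if u \<in> alice G then 2 * u else 2 * u + 1)"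

text \<open>Her copy of a vertex of Bob leaves Alice only the choice between passing the turn for
  free and a penalized arc.\<close>

lemma walk_from_alice_copy:
  assumes \<sigma>': "\<sigma>' \<in> alice_strategies H" and v: "v \<in> pverts (arena G)"
  shows "(\<exists>p. walk (alice_arcs H \<sigma>') (2 * v) p (owner_copy v) \<and> weight W p = 0) \<or>
    (\<exists>p x. walk (alice_arcs H \<sigma>') (2 * v) p x \<and> weight W p = - alice_penalty G w)"
proof (cases "v \<in> alice G")
  case True
  then show ?thesis
    by (intro disjI1 exI[of _ "[]"]) (simp add: owner_copy_def)
next
  case False
  have "(2 * v, \<sigma>' (2 * v)) \<in> parcs (arena H)"
    using \<sigma>' v by (auto simp: alice_strategies_def out_neighbors_def biclique_simps(2))
  then have a: "(2 * v, \<sigma>' (2 * v)) \<in> alice_arcs H \<sigma>'" and "odd (\<sigma>' (2 * v))"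
    by (auto simp: alice_arcs_def biclique_simps) presburger
  then obtain z where z: "\<sigma>' (2 * v) = 2 * z + 1"
    by (auto elim: oddE)
  show ?thesis
  proof (cases "z = v")
    case True
    have "walk (alice_arcs H \<sigma>') (2 * v) [(2 * v, 2 * v + 1)] (owner_copy v)"
      using a z True False by (simp add: owner_copy_def)
    moreover have "weight W [(2 * v, 2 * v + 1)] = 0"
      using False by (simp add: biclique_weight_def move_weight_def)
    ultimately show ?thesis
      by blast
  next
    case neq: False
    have "walk (alice_arcs H \<sigma>') (2 * v) [(2 * v, 2 * z + 1)] (2 * z + 1)"
      using a z by simp
    moreover have "weight W [(2 * v, 2 * z + 1)] = - alice_penalty G w"
      using False neq by (simp add: biclique_weight_def move_weight_def)
    ultimately show ?thesis
      by blast
  qed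
qed

text \<open>All arcs of Bob are available, so his part of the lift can be chosen freely and only
  Alice can spoil it: with a penalized arc at her own vertex \<open>u\<close>
  (\<open>?stop\<close>), or, after an original move of Bob, at her copy of \<open>v\<close>
  (\<open>?late\<close>), when the weight of that move is already collected.\<close>

lemma step_lift:
  assumes \<sigma>': "\<sigma>' \<in> alice_strategies H"
    and \<sigma>: "\<forall>u\<in>alice G. \<forall>v. \<sigma>' (2 * u) = 2 * v + 1 \<longrightarrow> (u, v) \<in> parcs (arena G) \<longrightarrow> \<sigma> u = v"
    and arc: "(u, v) \<in> alice_arcs G \<sigma>"
  shows "(\<exists>p. walk (alice_arcs H \<sigma>') (owner_copy u) p (owner_copy v) \<and> weight W p = w (u, v)) \<or>
    (\<exists>p x. walk (alice_arcs H \<sigma>') (owner_copy u) p x \<and> weight W p = - alice_penalty G w) \<or>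
    (\<exists>p x. walk (alice_arcs H \<sigma>') (owner_copy u) p x \<and> weight W p = w (u, v) - alice_penalty G w)"
    (is "?exact \<or> ?stop \<or> ?late")
proof -
  have E: "(u, v) \<in> parcs (arena G)" and uv: "u \<in> pverts (arena G)" "v \<in> pverts (arena G)"
    using arc game_graph_simps(7,8)[OF game] by (auto simp: alice_arcs_def)
  have bob_arc: "(2 * x + 1, 2 * y) \<in> alice_arcs H \<sigma>'"
    if "x \<in> pverts (arena G)" "y \<in> pverts (arena G)" for x y
  proof -
    have "2 * x + 1 \<notin> alice H"
      unfolding biclique_simps(2) by (clarsimp, presburger)
    with that show ?thesis
      by (simp add: alice_arcs_def biclique_simps(2-4))
  qed
  show ?thesis
  proof (cases "u \<in> alice G")
    case True
    have "(2 * u, \<sigma>' (2 * u)) \<in> parcs (arena H)"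
      using \<sigma>' uv by (auto simp: alice_strategies_def out_neighbors_def biclique_simps(2))
    then have a: "(2 * u, \<sigma>' (2 * u)) \<in> alice_arcs H \<sigma>'" and "odd (\<sigma>' (2 * u))"
      by (auto simp: alice_arcs_def biclique_simps) presburger
    then obtain z where z: "\<sigma>' (2 * u) = 2 * z + 1"
      by (auto elim: oddE)
    show ?thesis
    proof (cases "(u, z) \<in> parcs (arena G)")
      case arc_z: True
      then have "z = v"
        using \<sigma> True z arc by (simp add: alice_arcs_def)
      have weight: "W (2 * u, 2 * v + 1) = w (u, v)"
        using True E by (simp add: biclique_weight_def move_weight_def)
      show ?thesis
      proof (cases "v \<in> alice G")
        case False
        then have "walk (alice_arcs H \<sigma>') (owner_copy u) [(2 * u, 2 * v + 1)] (owner_copy v)"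
          using a z True \<open>z = v\<close> by (simp add: owner_copy_def)
        moreover have "weight W [(2 * u, 2 * v + 1)] = w (u, v)"
          using weight by simp
        ultimately have ?exact by blast
        then show ?thesis ..
      next
        case v: True
        \<comment> \<open>Alice's arc ends at Bob's copy of \<open>v\<close>; as \<open>v\<close>
          belongs to Alice, Bob passes the turn.\<close>
        have "walk (alice_arcs H \<sigma>') (owner_copy u) [(2 * u, 2 * v + 1), (2 * v + 1, 2 * v)]
            (owner_copy v)"
          using a z True \<open>z = v\<close> v bob_arc[OF uv(2,2)] by (simp add: owner_copy_def)
        moreover have "W (2 * v + 1, 2 * v) = 0"
          using v by (simp add: biclique_weight_def move_weight_def)
        then have "weight W [(2 * u, 2 * v + 1), (2 * v + 1, 2 * v)] = w (u, v)"
          using weight by simp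
        ultimately have ?exact by blast
        then show ?thesis ..
      qed
    next
      case False
      have "walk (alice_arcs H \<sigma>') (owner_copy u) [(2 * u, 2 * z + 1)] (2 * z + 1)"
        using a z True by (simp add: owner_copy_def)
      moreover have "weight W [(2 * u, 2 * z + 1)] = - alice_penalty G w"
        using True False by (simp add: biclique_weight_def move_weight_def)
      ultimately have ?stop by blast
      then show ?thesis by blast
    qed
  next
    case False
    have weight: "W (2 * u + 1, 2 * v) = w (u, v)"
      using False E by (simp add: biclique_weight_def move_weight_def)
    have lift: "walk (alice_arcs H \<sigma>') (owner_copy u) ((2 * u + 1, 2 * v) # p) x \<and>
        weight W ((2 * u + 1, 2 * v) # p) = w (u, v) + weight W p"
      if "walk (alice_arcs H \<sigma>') (2 * v) p x" for p x
      using that bob_arc[OF uv] False weight by (simp add: owner_copy_def)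
    from walk_from_alice_copy[OF \<sigma>' uv(2)] show ?thesis
    proof (elim disjE exE conjE)
      fix p assume p: "walk (alice_arcs H \<sigma>') (2 * v) p (owner_copy v)" "weight W p = 0"
      from lift[OF p(1)] p(2) have ?exact
        by (intro exI[of _ "(2 * u + 1, 2 * v) # p"]) (simp only: add_0_right simp_thms)
      then show ?thesis ..
    next
      fix p x assume p: "walk (alice_arcs H \<sigma>') (2 * v) p x" "weight W p = - alice_penalty G w"
      from lift[OF p(1)] p(2) have ?late
        by (intro exI[of _ "(2 * u + 1, 2 * v) # p"] exI[of _ x])
          (simp only: add_uminus_conv_diff simp_thms)
      then show ?thesis by blast
    qed
  qed
qed

text \<open>In the second alternative Alice uses a penalized arc after the prefix \<open>q\<close>.\<close>

lemma walk_lift: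
  assumes \<sigma>': "\<sigma>' \<in> alice_strategies H"
    and \<sigma>: "\<forall>u\<in>alice G. \<forall>v. \<sigma>' (2 * u) = 2 * v + 1 \<longrightarrow> (u, v) \<in> parcs (arena G) \<longrightarrow> \<sigma> u = v"
    and walk: "walk (alice_arcs G \<sigma>) u p v"
  shows "(\<exists>p'. walk (alice_arcs H \<sigma>') (owner_copy u) p' (owner_copy v) \<and> weight W p' = weight w p) \<or>
    (\<exists>q r p' x. p = q @ r \<and> walk (alice_arcs H \<sigma>') (owner_copy u) p' x \<and>
       weight W p' = weight w q - alice_penalty G w)"
  using walk
proof (induction p arbitrary: u)
  case Nil
  then show ?case
    by (intro disjI1 exI[of _ "[]"]) simp
next
  case (Cons e p)
  then obtain x where e: "e = (u, x)" "(u, x) \<in> alice_arcs G \<sigma>" "walk (alice_arcs G \<sigma>) x p v"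
    by (cases e) auto
  from step_lift[OF \<sigma>' \<sigma> e(2)] show ?case
  proof (elim disjE exE conjE)
    fix p\<^sub>1 assume p\<^sub>1: "walk (alice_arcs H \<sigma>') (owner_copy u) p\<^sub>1 (owner_copy x)"
      "weight W p\<^sub>1 = w (u, x)"
    from Cons.IH[OF e(3)] show ?thesis
    proof (elim disjE exE conjE)
      fix p\<^sub>2 assume "walk (alice_arcs H \<sigma>') (owner_copy x) p\<^sub>2 (owner_copy v)"
        "weight W p\<^sub>2 = weight w p"
      with p\<^sub>1 show ?thesis
        by (intro disjI1 exI[of _ "p\<^sub>1 @ p\<^sub>2"]) (auto simp: e(1))
    next
      fix q r p\<^sub>2 y assume "p = q @ r" "walk (alice_arcs H \<sigma>') (owner_copy x) p\<^sub>2 y"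
        "weight W p\<^sub>2 = weight w q - alice_penalty G w"
      with p\<^sub>1 show ?thesis
        by (intro disjI2 exI[of _ "e # q"] exI[of _ r] exI[of _ "p\<^sub>1 @ p\<^sub>2"] exI[of _ y])
          (auto simp: e(1))
    qed
  next
    fix p' y assume "walk (alice_arcs H \<sigma>') (owner_copy u) p' y" "weight W p' = - alice_penalty G w"
    then show ?thesis
      by (intro disjI2 exI[of _ "[]"] exI[of _ "e # p"] exI[of _ p'] exI[of _ y]) simp
  next
    fix p' y assume "walk (alice_arcs H \<sigma>') (owner_copy u) p' y"
      "weight W p' = w (u, x) - alice_penalty G w"
    then show ?thesis
      by (intro disjI2 exI[of _ "[e]"] exI[of _ p] exI[of _ p'] exI[of _ y]) (simp add: e(1))
  qed
qed

text \<open>Alice's strategy is read off from the biclique. A penalized arc after a prefix that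
  leaves no vertex twice would push the weight to at most
  \<open>S - alice_penalty G w < - int n\<close>; hence simple walks and lassos lift with their
  exact weights, and the bounds carry over.\<close>

lemma min_energy_biclique_ge:
  assumes s: "s \<in> pverts (arena G)" and n: "int n \<le> S" and le: "min_energy H W (2 * s) \<le> enat n"
  shows "min_energy G w s \<le> enat n"
proof -
  have "2 * s \<in> pverts (arena H)"
    using s by (simp add: biclique_simps)
  then obtain \<sigma>' where \<sigma>': "\<sigma>' \<in> alice_strategies H"
    and ge: "\<And>p v. walk (alice_arcs H \<sigma>') (2 * s) p v \<Longrightarrow> - int n \<le> weight W p"
    using le min_energy_le_iff[OF game_graph_biclique[OF game]] by blast
  \<comment> \<open>Where \<open>\<sigma>'\<close> uses a penalized arc, any move will do, as a
    lifted walk stops with that arc.\<close>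
  define \<sigma> where "\<sigma> = restrict (\<lambda>u. let v = \<sigma>' (2 * u) div 2 in
    if (u, v) \<in> parcs (arena G) then v else SOME v. (u, v) \<in> parcs (arena G)) (alice G)"
  have \<sigma>_eq: "\<forall>u\<in>alice G. \<forall>v. \<sigma>' (2 * u) = 2 * v + 1 \<longrightarrow> (u, v) \<in> parcs (arena G) \<longrightarrow> \<sigma> u = v"
    by (simp add: \<sigma>_def)
  have "(u, SOME v. (u, v) \<in> parcs (arena G)) \<in> parcs (arena G)" if "u \<in> alice G" for u
    by (rule someI_ex, rule game_graph_out_neighbor)
      (use game that game_graph_simps(5) in auto)
  then have \<sigma>: "\<sigma> \<in> alice_strategies G"
    by (auto simp: alice_strategies_def \<sigma>_def out_neighbors_def Let_def)
  have pen: "S - alice_penalty G w < - int n"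
    using n total_weight_nonneg[of G w] by (simp add: alice_penalty_def)
  \<comment> \<open>The energy is read at Alice's copy of \<open>s\<close>; if \<open>s\<close>
    belongs to Bob, the lift starts with her passing the turn.\<close>
  obtain p\<^sub>0 where p\<^sub>0: "walk (alice_arcs H \<sigma>') (2 * s) p\<^sub>0 (owner_copy s)" "weight W p\<^sub>0 = 0"
  proof -
    have "\<not> - int n \<le> - alice_penalty G w"
      using pen total_weight_nonneg[of G w] by linarith
    with ge walk_from_alice_copy[OF \<sigma>' s] that show thesis
      by metis
  qed
  have prefix_le: "weight w q \<le> S" if "walk (alice_arcs G \<sigma>) s p v" "distinct (map fst p)" "p = q @ r"
    for p q r v
  proof -
    have "set q \<subseteq> parcs (arena G)" "distinct (map fst q)"
      using that by (auto simp: walk_def alice_arcs_def)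
    from abs_weight_le_total_weight[OF game this, of w] show ?thesis
      by linarith
  qed
  note lift = walk_lift[where \<sigma> = \<sigma>, OF \<sigma>' \<sigma>_eq]
  have exact: "\<exists>p'. walk (alice_arcs H \<sigma>') (2 * s) p' (owner_copy v) \<and> weight W p' = weight w p"
    if p: "walk (alice_arcs G \<sigma>) s p v" "distinct (map fst p)" for p v
    using lift[OF p(1)]
  proof (elim disjE exE conjE)
    fix p' assume "walk (alice_arcs H \<sigma>') (owner_copy s) p' (owner_copy v)" "weight W p' = weight w p"
    with p\<^sub>0 show ?thesis
      by (intro exI[of _ "p\<^sub>0 @ p'"]) auto
  next
    fix q r p' x assume *: "p = q @ r" "walk (alice_arcs H \<sigma>') (owner_copy s) p' x"
      "weight W p' = weight w q - alice_penalty G w"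
    have "walk (alice_arcs H \<sigma>') (2 * s) (p\<^sub>0 @ p') x"
      using p\<^sub>0 * by auto
    from ge[OF this] prefix_le[OF p *(1)] pen * p\<^sub>0(2) have False
      by simp
    then show ?thesis ..
  qed
  have "- int n \<le> weight w p" if "walk (alice_arcs G \<sigma>) s p v" for p v
  proof (rule walk_weight_ge[OF _ _ that])
    fix p v assume "walk (alice_arcs G \<sigma>) s p v" "distinct (map fst p @ [v])"
    then show "- int n \<le> weight w p"
      using exact[of p v] ge by fastforce
  next
    fix q c a assume qc: "walk (alice_arcs G \<sigma>) s q a" "walk (alice_arcs G \<sigma>) a c a"
      "distinct (map fst (q @ c))"
    obtain q' where q': "walk (alice_arcs H \<sigma>') (2 * s) q' (owner_copy a)" "weight W q' = weight w q"
      using exact[OF qc(1)] qc(3) by auto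
    show "0 \<le> weight w c"
      using lift[OF qc(2)]
    proof (elim disjE exE conjE)
      fix c' assume c': "walk (alice_arcs H \<sigma>') (owner_copy a) c' (owner_copy a)"
        "weight W c' = weight w c"
      show ?thesis
      proof (rule ccontr)
        assume "\<not> 0 \<le> weight w c"
        with walk_pump[OF q'(1) c'(1), of W "- int n"] c'(2) ge show False
          by (metis not_le)
      qed
    next
      fix c\<^sub>1 c\<^sub>2 p' x assume *: "c = c\<^sub>1 @ c\<^sub>2" "walk (alice_arcs H \<sigma>') (owner_copy a) p' x"
        "weight W p' = weight w c\<^sub>1 - alice_penalty G w"
      have "walk (alice_arcs H \<sigma>') (2 * s) (q' @ p') x"
        using q' * by auto
      \<comment> \<open>The gain before the penalized arc consists of \<open>q\<close> and a part of
        \<open>c\<close>; it is bounded on the whole lasso, which leaves no vertex twice.\<close>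
      moreover have "walk (alice_arcs G \<sigma>) s (q @ c) a"
        using qc by auto
      from prefix_le[OF this qc(3), of "q @ c\<^sub>1" c\<^sub>2] have "weight w q + weight w c\<^sub>1 \<le> S"
        using *(1) by simp
      ultimately have False
        using ge[of "q' @ p'" x] pen * q'(2) by simp
      then show ?thesis ..
    qed
  qed
  with \<sigma> show ?thesis
    unfolding min_energy_le_iff[OF game s] by blast
qed

text \<open>The two games satisfy the same bounds up to \<open>S\<close>, and a finite energy of
  \<open>G\<close> never exceeds \<open>S\<close>.\<close>

lemma min_energy_biclique:
  assumes s: "s \<in> pverts (arena G)"
  shows "min_energy G w s =
    (if min_energy H W (2 * s) \<le> enat (nat S) then min_energy H W (2 * s) else \<infinity>)"
proof -
  have iff: "min_energy H W (2 * s) \<le> enat n \<longleftrightarrow> min_energy G w s \<le> enat n" if "n \<le> nat S" for n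
  proof -
    have "int n \<le> S"
      using that total_weight_nonneg[of G w] by linarith
    from min_energy_biclique_le[OF s this] min_energy_biclique_ge[OF s this] show ?thesis
      by blast
  qed
  show ?thesis
  proof (cases "min_energy H W (2 * s) \<le> enat (nat S)")
    case True
    have "min_energy G w s = min_energy H W (2 * s)"
    proof (rule enat_eqI)
      fix n
      show "min_energy G w s \<le> enat n \<longleftrightarrow> min_energy H W (2 * s) \<le> enat n"
      proof (cases "n \<le> nat S")
        case False
        then have "enat (nat S) \<le> enat n"
          by simp
        with True iff[OF order_refl] show ?thesis
          by (meson order_trans)
      qed (simp add: iff)
    qed
    with True show ?thesis
      by simp
  next
    case False
    with iff[OF order_refl] have "min_energy G w s = \<infinity>"
      using finite_min_energy_le_total_weight[OF game s, of w] by blast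
    with False show ?thesis
      by simp
  qed
qed

end


section \<open>Polynomial-time functions on binary trees\<close>

lemma poly_nat_mono:
  fixes p :: "nat poly"
  assumes "a \<le> b"
  shows "poly p a \<le> poly p b"
  by (induction p) (auto intro!: add_mono mult_mono assms)

lemma bit_size_pos: "0 < bit_size v"
  by (cases v) auto

lemma bit_size_val_left: "bit_size (val_left v) \<le> bit_size v"
  by (cases v) (auto simp: floorlog_def)

lemma bit_size_val_right: "bit_size (val_right v) \<le> bit_size v"
  by (cases v) (auto simp: floorlog_def)

lemma bit_size_Leaf_mono: "\<bar>i\<bar> \<le> \<bar>j\<bar> \<Longrightarrow> bit_size (Leaf i) \<le> bit_size (Leaf j)"
  by (simp add: floorlog_mono nat_mono)

text \<open>The sum has at most one bit more than the summands together; the unit charged for the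
  second leaf pays for it.\<close>

lemma bit_size_Leaf_add: "bit_size (Leaf (i + j)) \<le> bit_size (Leaf i) + bit_size (Leaf j)"
proof -
  have less: "nat \<bar>k\<bar> < 2 ^ floorlog 2 (nat \<bar>k\<bar>)" for k :: int
    using floorlog_bounds[of "nat \<bar>k\<bar>" 2] by (cases "k = 0") (auto simp: floorlog_def)
  let ?m = "floorlog 2 (nat \<bar>i\<bar>)" and ?n = "floorlog 2 (nat \<bar>j\<bar>)"
  have "nat \<bar>i + j\<bar> \<le> nat \<bar>i\<bar> + nat \<bar>j\<bar>"
    by linarith
  also have "\<dots> < 2 ^ ?m + 2 ^ ?n"
    by (intro add_strict_mono less)
  also have "\<dots> \<le> 2 ^ (?m + ?n) + 2 ^ (?m + ?n)"
    by (intro add_mono power_increasing) auto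
  also have "\<dots> = 2 ^ Suc (?m + ?n)"
    by simp
  finally have "floorlog 2 (nat \<bar>i + j\<bar>) \<le> Suc (?m + ?n)"
    by (intro floorlog_leI) auto
  then show ?thesis
    by simp
qed

lemma bit_size_val_int: "bit_size (Leaf (val_int v)) \<le> bit_size v"
  by (cases v) (auto simp: floorlog_def)

lemma bit_size_val_bool: "bit_size (val_bool b) \<le> 2"
  by (simp add: val_bool_def floorlog_def)

lemma bit_size_le_expr_cost: "bit_size (eval_expr e s) \<le> expr_cost e s"
  by (cases e) auto

text \<open>Storing a value is charged at least its size. This turns time bounds into size
  bounds.\<close>

lemma exec_bit_size_le: "exec f c s t s' \<Longrightarrow> bit_size (s' x) \<le> bit_size (s x) + t"
proof (induction rule: exec.induct)
  case (exec_Assign y a s)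
  then show ?case
    using bit_size_le_expr_cost[of a s] by (cases "x = y") auto
qed auto

text \<open>The program may be run in any state, and it leaves almost all variables untouched, so that
  it can be used as a subroutine.\<close>

definition computes :: "com \<Rightarrow> nat \<Rightarrow> nat poly \<Rightarrow> (val \<Rightarrow> val) \<Rightarrow> bool" where
  "computes c N p F \<longleftrightarrow> (\<forall>f s. \<exists>t s'. exec f c s t s' \<and> t \<le> poly p (bit_size (s 0)) \<and>
     s' 0 = F (s 0) \<and> (\<forall>x\<ge>N. s' x = s x))"

definition polytime :: "(val \<Rightarrow> val) \<Rightarrow> bool" where
  "polytime F \<longleftrightarrow> (\<exists>c N p. computes c N p F)"

lemma computesE:
  assumes "computes c N p F"
  obtains t s' where "exec f c s t s'" "t \<le> poly p (bit_size (s 0))" "s' 0 = F (s 0)"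
    "\<And>x. N \<le> x \<Longrightarrow> s' x = s x" "bit_size (F (s 0)) \<le> bit_size (s 0) + poly p (bit_size (s 0))"
proof -
  obtain t s' where *: "exec f c s t s'" "t \<le> poly p (bit_size (s 0))" "s' 0 = F (s 0)"
    "\<And>x. N \<le> x \<Longrightarrow> s' x = s x"
    using assms unfolding computes_def by blast
  moreover have "bit_size (F (s 0)) \<le> bit_size (s 0) + poly p (bit_size (s 0))"
    using exec_bit_size_le[OF *(1), of 0] * by simp
  ultimately show thesis
    by (rule that)
qed

lemma polytime_bit_size:
  assumes "polytime F"
  obtains p :: "nat poly" where "\<And>x. bit_size (F x) \<le> poly p (bit_size x)"
proof -
  obtain c N p where c: "computes c N p F"
    using assms by (auto simp: polytime_def)
  have "bit_size (F x) \<le> poly ([:0, 1:] + p) (bit_size x)" for x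
    by (rule computesE[OF c, where s = "\<lambda>_. x"]) simp
  then show thesis
    by (rule that)
qed

lemma polytime_expr:
  assumes "\<And>s. eval_expr e s = F (s 0)" "\<And>s. expr_cost e s \<le> k * bit_size (s 0)"
  shows "polytime F"
proof -
  have "computes (Assign 0 e) 1 [:1, k:] F"
    unfolding computes_def
  proof (intro allI exI conjI)
    fix f and s :: state
    show "exec f (Assign 0 e) s (1 + expr_cost e s) (s(0 := eval_expr e s))"
      by (rule exec_Assign)
    show "1 + expr_cost e s \<le> poly [:1, k:] (bit_size (s 0))"
      using assms(2)[of s] by (simp add: mult.commute)
  qed (auto simp: assms(1))
  then show ?thesis
    by (auto simp: polytime_def)
qed

lemma polytime_comp:
  assumes "polytime F" "polytime G"
  shows "polytime (\<lambda>x. F (G x))"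
proof -
  obtain c\<^sub>F N\<^sub>F p\<^sub>F c\<^sub>G N\<^sub>G p\<^sub>G where F: "computes c\<^sub>F N\<^sub>F p\<^sub>F F" and G: "computes c\<^sub>G N\<^sub>G p\<^sub>G G"
    using assms by (auto simp: polytime_def)
  have "computes (Seq c\<^sub>G c\<^sub>F) (max N\<^sub>F N\<^sub>G) (1 + p\<^sub>G + pcompose p\<^sub>F ([:0, 1:] + p\<^sub>G)) (\<lambda>x. F (G x))"
    unfolding computes_def
  proof (intro allI)
    fix f and s :: state
    let ?n = "bit_size (s 0)"
    obtain t\<^sub>1 s\<^sub>1 where 1: "exec f c\<^sub>G s t\<^sub>1 s\<^sub>1" "t\<^sub>1 \<le> poly p\<^sub>G ?n" "s\<^sub>1 0 = G (s 0)"
      "\<And>x. N\<^sub>G \<le> x \<Longrightarrow> s\<^sub>1 x = s x" "bit_size (G (s 0)) \<le> ?n + poly p\<^sub>G ?n"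
      using computesE[OF G] by metis
    obtain t\<^sub>2 s\<^sub>2 where 2: "exec f c\<^sub>F s\<^sub>1 t\<^sub>2 s\<^sub>2" "t\<^sub>2 \<le> poly p\<^sub>F (bit_size (s\<^sub>1 0))" "s\<^sub>2 0 = F (s\<^sub>1 0)"
      "\<And>x. N\<^sub>F \<le> x \<Longrightarrow> s\<^sub>2 x = s\<^sub>1 x"
      using computesE[OF F] by metis
    have "t\<^sub>2 \<le> poly p\<^sub>F (?n + poly p\<^sub>G ?n)"
      using 2(2) 1(3,5) poly_nat_mono[of _ "?n + poly p\<^sub>G ?n" p\<^sub>F] by (metis le_trans)
    then show "\<exists>t s'. exec f (Seq c\<^sub>G c\<^sub>F) s t s' \<and>
        t \<le> poly (1 + p\<^sub>G + pcompose p\<^sub>F ([:0, 1:] + p\<^sub>G)) ?n \<and>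
        s' 0 = F (G (s 0)) \<and> (\<forall>x\<ge>max N\<^sub>F N\<^sub>G. s' x = s x)"
      using 1 2 exec_Seq[OF 1(1) 2(1)] by (intro exI[of _ "1 + t\<^sub>1 + t\<^sub>2"] exI[of _ s\<^sub>2])
        (auto simp: poly_pcompose)
  qed
  then show ?thesis
    by (auto simp: polytime_def)
qed

lemma polytime_Node:
  assumes "polytime F" "polytime G"
  shows "polytime (\<lambda>x. Node (F x) (G x))"
proof -
  obtain c\<^sub>F N\<^sub>F p\<^sub>F c\<^sub>G N\<^sub>G p\<^sub>G where F: "computes c\<^sub>F N\<^sub>F p\<^sub>F F" and G: "computes c\<^sub>G N\<^sub>G p\<^sub>G G"
    using assms by (auto simp: polytime_def)
  define a where "a = Suc (max N\<^sub>F N\<^sub>G)"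
  define b where "b = Suc a"
  have ab: "N\<^sub>F \<le> a" "N\<^sub>F \<le> b" "N\<^sub>G \<le> a" "N\<^sub>G \<le> b" "a \<noteq> b" "a \<noteq> 0" "b \<noteq> 0" "a < Suc b"
    by (auto simp: a_def b_def)
  \<comment> \<open>Both programs overwrite variable 0. The input survives in \<open>a\<close> and
    the first result in \<open>b\<close>, which neither program touches while they are
    needed.\<close>
  define c where "c = Seq (Assign a (Var 0)) (Seq c\<^sub>F (Seq (Assign b (Var 0))
    (Seq (Assign 0 (Var a)) (Seq c\<^sub>G (Assign 0 (MkNode (Var b) (Var 0)))))))"
  have "computes c (Suc b) ([:20, 20:] + smult 10 p\<^sub>F + smult 10 p\<^sub>G) (\<lambda>x. Node (F x) (G x))"
    unfolding computes_def
  proof (intro allI)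
    fix f and s :: state
    let ?n = "bit_size (s 0)"
    define s\<^sub>1 where "s\<^sub>1 = s(a := s 0)"
    have s\<^sub>1: "s\<^sub>1 0 = s 0" "s\<^sub>1 a = s 0"
      using ab by (simp_all add: s\<^sub>1_def)
    have e\<^sub>1: "exec f (Assign a (Var 0)) s (1 + ?n) s\<^sub>1"
      using exec_Assign[of f a "Var 0" s] by (simp add: s\<^sub>1_def)
    obtain t\<^sub>2 s\<^sub>2 where 2: "exec f c\<^sub>F s\<^sub>1 t\<^sub>2 s\<^sub>2" "t\<^sub>2 \<le> poly p\<^sub>F ?n" "s\<^sub>2 0 = F (s 0)"
      "\<And>x. N\<^sub>F \<le> x \<Longrightarrow> s\<^sub>2 x = s\<^sub>1 x" "bit_size (F (s 0)) \<le> ?n + poly p\<^sub>F ?n"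
      using computesE[OF F, where s = s\<^sub>1] s\<^sub>1 by metis
    define s\<^sub>3 where "s\<^sub>3 = s\<^sub>2(b := s\<^sub>2 0, 0 := s 0)"
    have s\<^sub>3: "s\<^sub>3 0 = s 0" "s\<^sub>3 b = F (s 0)"
      using ab 2 by (simp_all add: s\<^sub>3_def)
    have s\<^sub>2a: "s\<^sub>2 a = s 0"
      using 2 s\<^sub>1 ab by simp
    have e\<^sub>3: "exec f (Assign b (Var 0)) s\<^sub>2 (1 + bit_size (F (s 0))) (s\<^sub>2(b := s\<^sub>2 0))"
      using exec_Assign[of f b "Var 0" s\<^sub>2] 2(3) by simp
    have e\<^sub>4: "exec f (Assign 0 (Var a)) (s\<^sub>2(b := s\<^sub>2 0)) (1 + ?n) s\<^sub>3"
      using exec_Assign[of f 0 "Var a" "s\<^sub>2(b := s\<^sub>2 0)"] s\<^sub>2a ab by (simp add: s\<^sub>3_def)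
    obtain t\<^sub>5 s\<^sub>5 where 5: "exec f c\<^sub>G s\<^sub>3 t\<^sub>5 s\<^sub>5" "t\<^sub>5 \<le> poly p\<^sub>G ?n" "s\<^sub>5 0 = G (s 0)"
      "\<And>x. N\<^sub>G \<le> x \<Longrightarrow> s\<^sub>5 x = s\<^sub>3 x" "bit_size (G (s 0)) \<le> ?n + poly p\<^sub>G ?n"
      using computesE[OF G, where s = s\<^sub>3] s\<^sub>3 by metis
    have s\<^sub>5b: "s\<^sub>5 b = F (s 0)"
      using 5 s\<^sub>3 ab by simp
    define s\<^sub>6 where "s\<^sub>6 = s\<^sub>5(0 := Node (F (s 0)) (G (s 0)))"
    have e\<^sub>6: "exec f (Assign 0 (MkNode (Var b) (Var 0))) s\<^sub>5
        (2 + 2 * bit_size (F (s 0)) + 2 * bit_size (G (s 0))) s\<^sub>6"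
      using exec_Assign[of f 0 "MkNode (Var b) (Var 0)" s\<^sub>5] s\<^sub>5b 5(3) by (simp add: s\<^sub>6_def mult_2 ac_simps)
    note run = exec_Seq[OF e\<^sub>1 exec_Seq[OF 2(1) exec_Seq[OF e\<^sub>3 exec_Seq[OF e\<^sub>4 exec_Seq[OF 5(1) e\<^sub>6]]]]]
    show "\<exists>t s'. exec f c s t s' \<and>
        t \<le> poly ([:20, 20:] + smult 10 p\<^sub>F + smult 10 p\<^sub>G) ?n \<and>
        s' 0 = Node (F (s 0)) (G (s 0)) \<and> (\<forall>x\<ge>Suc b. s' x = s x)"
    proof (intro exI conjI allI impI, rule run[folded c_def])
      show "s\<^sub>6 0 = Node (F (s 0)) (G (s 0))"
        by (simp add: s\<^sub>6_def)
      show "s\<^sub>6 x = s x" if "Suc b \<le> x" for x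
        using that ab 2(4)[of x] 5(4)[of x] by (simp add: s\<^sub>6_def s\<^sub>3_def s\<^sub>1_def)
    qed (use 2(2,5) 5(2,5) in simp)
  qed
  then show ?thesis
    by (auto simp: polytime_def)
qed

lemma polytime_If:
  assumes "polytime B" "polytime F" "polytime G"
  shows "polytime (\<lambda>x. if B x = Leaf 0 then F x else G x)"
proof -
  obtain c\<^sub>B N\<^sub>B p\<^sub>B c\<^sub>F N\<^sub>F p\<^sub>F c\<^sub>G N\<^sub>G p\<^sub>G where B: "computes c\<^sub>B N\<^sub>B p\<^sub>B B"
    and F: "computes c\<^sub>F N\<^sub>F p\<^sub>F F" and G: "computes c\<^sub>G N\<^sub>G p\<^sub>G G"
    using assms by (auto simp: polytime_def)
  define a where "a = Suc (max N\<^sub>B (max N\<^sub>F N\<^sub>G))"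
  define b where "b = Suc a"
  have ab: "N\<^sub>B \<le> a" "N\<^sub>B \<le> b" "a \<noteq> b" "a \<noteq> 0" "b \<noteq> 0" "a < Suc b" "N\<^sub>F \<le> a" "N\<^sub>G \<le> a"
    by (auto simp: a_def b_def)
  \<comment> \<open>\<open>Cond\<close> takes its first branch on values other than
    \<open>Leaf 0\<close>, hence the order \<open>c\<^sub>G\<close>,
    \<open>c\<^sub>F\<close>.\<close>
  define c where "c = Seq (Assign a (Var 0)) (Seq c\<^sub>B (Seq (Assign b (Var 0))
    (Seq (Assign 0 (Var a)) (Cond (Var b) c\<^sub>G c\<^sub>F))))"
  have "computes c (Suc b) ([:20, 20:] + smult 10 p\<^sub>B + smult 10 p\<^sub>F + smult 10 p\<^sub>G)
      (\<lambda>x. if B x = Leaf 0 then F x else G x)"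
    unfolding computes_def
  proof (intro allI)
    fix f and s :: state
    let ?n = "bit_size (s 0)"
    define s\<^sub>1 where "s\<^sub>1 = s(a := s 0)"
    have s\<^sub>1: "s\<^sub>1 0 = s 0" "s\<^sub>1 a = s 0"
      using ab by (simp_all add: s\<^sub>1_def)
    have e\<^sub>1: "exec f (Assign a (Var 0)) s (1 + ?n) s\<^sub>1"
      using exec_Assign[of f a "Var 0" s] by (simp add: s\<^sub>1_def)
    obtain t\<^sub>2 s\<^sub>2 where 2: "exec f c\<^sub>B s\<^sub>1 t\<^sub>2 s\<^sub>2" "t\<^sub>2 \<le> poly p\<^sub>B ?n" "s\<^sub>2 0 = B (s 0)"
      "\<And>x. N\<^sub>B \<le> x \<Longrightarrow> s\<^sub>2 x = s\<^sub>1 x" "bit_size (B (s 0)) \<le> ?n + poly p\<^sub>B ?n"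
      using computesE[OF B, where s = s\<^sub>1] s\<^sub>1 by metis
    define s\<^sub>3 where "s\<^sub>3 = s\<^sub>2(b := s\<^sub>2 0, 0 := s 0)"
    have s\<^sub>3: "s\<^sub>3 0 = s 0" "s\<^sub>3 b = B (s 0)"
      using ab 2 by (simp_all add: s\<^sub>3_def)
    have s\<^sub>2a: "s\<^sub>2 a = s 0"
      using 2 s\<^sub>1 ab by simp
    have e\<^sub>3: "exec f (Assign b (Var 0)) s\<^sub>2 (1 + bit_size (B (s 0))) (s\<^sub>2(b := s\<^sub>2 0))"
      using exec_Assign[of f b "Var 0" s\<^sub>2] 2(3) by simp
    have e\<^sub>4: "exec f (Assign 0 (Var a)) (s\<^sub>2(b := s\<^sub>2 0)) (1 + ?n) s\<^sub>3"
      using exec_Assign[of f 0 "Var a" "s\<^sub>2(b := s\<^sub>2 0)"] s\<^sub>2a ab by (simp add: s\<^sub>3_def)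
    have "\<exists>t\<^sub>5 s\<^sub>5. exec f (Cond (Var b) c\<^sub>G c\<^sub>F) s\<^sub>3 (1 + bit_size (B (s 0)) + t\<^sub>5) s\<^sub>5 \<and>
        t\<^sub>5 \<le> poly p\<^sub>F ?n + poly p\<^sub>G ?n \<and> s\<^sub>5 0 = (if B (s 0) = Leaf 0 then F (s 0) else G (s 0)) \<and>
        (\<forall>x\<ge>a. s\<^sub>5 x = s\<^sub>3 x)"
    proof (cases "B (s 0) = Leaf 0")
      case True
      obtain t\<^sub>5 s\<^sub>5 where "exec f c\<^sub>F s\<^sub>3 t\<^sub>5 s\<^sub>5" "t\<^sub>5 \<le> poly p\<^sub>F ?n" "s\<^sub>5 0 = F (s 0)"
        "\<And>x. N\<^sub>F \<le> x \<Longrightarrow> s\<^sub>5 x = s\<^sub>3 x"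
        using computesE[OF F, where s = s\<^sub>3] s\<^sub>3 by metis
      with True s\<^sub>3 ab exec_CondFalse[of "Var b" s\<^sub>3 f c\<^sub>F t\<^sub>5 s\<^sub>5 c\<^sub>G] show ?thesis
        by (intro exI[of _ t\<^sub>5] exI[of _ s\<^sub>5]) auto
    next
      case False
      obtain t\<^sub>5 s\<^sub>5 where "exec f c\<^sub>G s\<^sub>3 t\<^sub>5 s\<^sub>5" "t\<^sub>5 \<le> poly p\<^sub>G ?n" "s\<^sub>5 0 = G (s 0)"
        "\<And>x. N\<^sub>G \<le> x \<Longrightarrow> s\<^sub>5 x = s\<^sub>3 x"
        using computesE[OF G, where s = s\<^sub>3] s\<^sub>3 by metis
      with False s\<^sub>3 ab exec_CondTrue[of "Var b" s\<^sub>3 f c\<^sub>G t\<^sub>5 s\<^sub>5 c\<^sub>F] show ?thesis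
        by (intro exI[of _ t\<^sub>5] exI[of _ s\<^sub>5]) auto
    qed
    then obtain t\<^sub>5 s\<^sub>5 where 5: "exec f (Cond (Var b) c\<^sub>G c\<^sub>F) s\<^sub>3 (1 + bit_size (B (s 0)) + t\<^sub>5) s\<^sub>5"
        "t\<^sub>5 \<le> poly p\<^sub>F ?n + poly p\<^sub>G ?n" "s\<^sub>5 0 = (if B (s 0) = Leaf 0 then F (s 0) else G (s 0))"
        "\<And>x. a \<le> x \<Longrightarrow> s\<^sub>5 x = s\<^sub>3 x"
      by blast
    note run = exec_Seq[OF e\<^sub>1 exec_Seq[OF 2(1) exec_Seq[OF e\<^sub>3 exec_Seq[OF e\<^sub>4 5(1)]]]]
    show "\<exists>t s'. exec f c s t s' \<and>
        t \<le> poly ([:20, 20:] + smult 10 p\<^sub>B + smult 10 p\<^sub>F + smult 10 p\<^sub>G) ?n \<and>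
        s' 0 = (if B (s 0) = Leaf 0 then F (s 0) else G (s 0)) \<and> (\<forall>x\<ge>Suc b. s' x = s x)"
    proof (intro exI conjI allI impI, rule run[folded c_def])
      show "s\<^sub>5 x = s x" if "Suc b \<le> x" for x
        using that ab 2(4)[of x] 5(4)[of x] by (simp add: s\<^sub>3_def s\<^sub>1_def)
    qed (use 2(2,5) 5(2,3) in simp_all)
  qed
  then show ?thesis
    by (auto simp: polytime_def)
qed

section \<open>Folds over encoded lists\<close>

fun vfold :: "(val \<Rightarrow> val \<Rightarrow> val) \<Rightarrow> val \<Rightarrow> val \<Rightarrow> val" where
  "vfold g (Node a l) acc = vfold g l (g a acc)"
| "vfold g (Leaf i) acc = acc"

primrec vlength :: "val \<Rightarrow> nat" where
  "vlength (Node a l) = Suc (vlength l)"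
| "vlength (Leaf i) = 0"

lemma vlength_less_bit_size: "vlength l < bit_size l"
  by (induction l) auto

text \<open>Growth that is additive in the accumulator stays linear in the number of rounds.
  Elements are no larger than the list, so one \<open>d\<close> serves for all of them.\<close>

lemma bit_size_vfold:
  assumes "\<And>a acc. bit_size a \<le> bit_size l \<Longrightarrow> bit_size (g a acc) \<le> bit_size acc + d"
  shows "bit_size (vfold g l acc) \<le> bit_size acc + vlength l * d"
  using assms
proof (induction l arbitrary: acc)
  case (Node a l)
  have "bit_size (vfold g l (g a acc)) \<le> bit_size (g a acc) + vlength l * d"
    by (rule Node.IH(2)) (rule Node.prems, simp)
  also have "bit_size (g a acc) \<le> bit_size acc + d"
    by (rule Node.prems) simp
  finally show ?case
    by simp
qed simp

text \<open>\<open>bit_size acc + vlength xs * d\<close> does not increase: a round adds at most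
  \<open>d\<close> and shortens the list by one. So \<open>B\<close> bounds everything in the
  variables of the loop at all times, and \<open>2 + 3 * B\<close> the argument of the step.
  \<open>L\<close> stays fixed while the list shrinks.\<close>

lemma exec_fold_loop:
  assumes S: "computes c N p S"
    and vars: "N \<le> a" "N \<le> l" "N \<le> r" "distinct [0, a, l, r]"
    and grow: "\<And>e acc. bit_size e \<le> L \<Longrightarrow> bit_size (S (Node ctx (Node e acc))) \<le> bit_size acc + d"
  defines "loop \<equiv> While (IsNode (Var l))
    (Seq (Assign 0 (MkNode (Var a) (MkNode (Left (Var l)) (Var r))))
      (Seq c (Seq (Assign r (Var 0)) (Assign l (Right (Var l))))))"
  assumes "s a = ctx" "s l = xs" "s r = acc" "bit_size xs \<le> L" "L \<le> B" "bit_size ctx \<le> B"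
    "bit_size acc + vlength xs * d \<le> B"
  shows "\<exists>t s'. exec f loop s t s' \<and> s' r = vfold (\<lambda>e acc. S (Node ctx (Node e acc))) xs acc \<and>
    (\<forall>x. N \<le> x \<longrightarrow> x \<notin> {0, a, l, r} \<longrightarrow> s' x = s x) \<and>
    t \<le> (vlength xs + 1) * (20 + 20 * B + poly p (2 + 3 * B))"
  using assms(8-)
proof (induction xs arbitrary: s acc)
  case (Leaf i)
  have "exec f loop s (1 + expr_cost (IsNode (Var l)) s) s"
    unfolding loop_def using Leaf by (intro exec_WhileFalse) (simp add: val_bool_def)
  moreover have "1 + expr_cost (IsNode (Var l)) s \<le> 20 + 20 * B + poly p (2 + 3 * B)"
    using Leaf bit_size_val_bool[of False] by simp
  ultimately show ?case
    using Leaf by (auto intro!: exI)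
next
  case (Node e xs)
  let ?K = "20 + 20 * B + poly p (2 + 3 * B)"
  have size: "bit_size e + bit_size xs < B"
    using Node.prems by simp
  have acc: "bit_size acc + d + vlength xs * d \<le> B"
    using Node.prems by simp
  define acc' where "acc' = S (Node ctx (Node e acc))"
  have acc': "bit_size acc' \<le> bit_size acc + d"
    unfolding acc'_def by (rule grow) (use Node.prems in simp)
  let ?pair = "MkNode (Var a) (MkNode (Left (Var l)) (Var r))"
  define s\<^sub>1 where "s\<^sub>1 = s(0 := Node ctx (Node e acc))"
  have e\<^sub>1: "exec f (Assign 0 ?pair) s (1 + expr_cost ?pair s) s\<^sub>1"
    using exec_Assign[of f 0 ?pair s] Node.prems by (simp add: s\<^sub>1_def)
  have t\<^sub>1: "expr_cost ?pair s \<le> 4 + 9 * B"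
    using size acc Node.prems by simp
  obtain t\<^sub>2 s\<^sub>2 where 2: "exec f c s\<^sub>1 t\<^sub>2 s\<^sub>2" "t\<^sub>2 \<le> poly p (bit_size (s\<^sub>1 0))" "s\<^sub>2 0 = acc'"
    "\<And>x. N \<le> x \<Longrightarrow> s\<^sub>2 x = s\<^sub>1 x"
    by (rule computesE[OF S, where s = s\<^sub>1 and f = f]) (auto simp: s\<^sub>1_def acc'_def)
  have "bit_size (s\<^sub>1 0) \<le> 2 + 3 * B"
    using size acc Node.prems by (simp add: s\<^sub>1_def)
  with 2(2) have t\<^sub>2: "t\<^sub>2 \<le> poly p (2 + 3 * B)"
    using poly_nat_mono le_trans by blast
  have s\<^sub>2: "s\<^sub>2 a = ctx" "s\<^sub>2 l = Node e xs"
    using 2(4) vars Node.prems by (simp_all add: s\<^sub>1_def)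
  have e\<^sub>3: "exec f (Assign r (Var 0)) s\<^sub>2 (1 + bit_size acc') (s\<^sub>2(r := acc'))"
    using exec_Assign[of f r "Var 0" s\<^sub>2] 2(3) by simp
  define s\<^sub>4 where "s\<^sub>4 = s\<^sub>2(r := acc', l := xs)"
  have e\<^sub>4: "exec f (Assign l (Right (Var l))) (s\<^sub>2(r := acc'))
      (1 + (bit_size (Node e xs) + bit_size xs)) s\<^sub>4"
    using exec_Assign[of f l "Right (Var l)" "s\<^sub>2(r := acc')"] s\<^sub>2 vars by (simp add: s\<^sub>4_def)
  have "s\<^sub>4 a = ctx" "s\<^sub>4 l = xs" "s\<^sub>4 r = acc'"
    using s\<^sub>2 vars by (auto simp: s\<^sub>4_def)
  moreover have "bit_size xs \<le> L" "bit_size acc' + vlength xs * d \<le> B"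
    using Node.prems acc acc' by simp_all
  ultimately obtain t\<^sub>5 s\<^sub>5 where 5: "exec f loop s\<^sub>4 t\<^sub>5 s\<^sub>5"
    "s\<^sub>5 r = vfold (\<lambda>e acc. S (Node ctx (Node e acc))) xs acc'"
    "\<forall>x. N \<le> x \<longrightarrow> x \<notin> {0, a, l, r} \<longrightarrow> s\<^sub>5 x = s\<^sub>4 x"
    "t\<^sub>5 \<le> (vlength xs + 1) * ?K"
    using Node.IH(2)[of s\<^sub>4 acc'] Node.prems by blast
  have test: "eval_expr (IsNode (Var l)) s \<noteq> Leaf 0"
    using Node.prems by (simp add: val_bool_def)
  have t\<^sub>0: "expr_cost (IsNode (Var l)) s \<le> 2 + B"
    using Node.prems bit_size_val_bool[of True] by simp
  note run = exec_WhileTrue[OF test exec_Seq[OF e\<^sub>1 exec_Seq[OF 2(1) exec_Seq[OF e\<^sub>3 e\<^sub>4]]]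
    5(1)[unfolded loop_def], folded loop_def]
  show ?case
  proof (intro exI conjI allI impI, rule run)
    show "s\<^sub>5 r = vfold (\<lambda>e acc. S (Node ctx (Node e acc))) (Node e xs) acc"
      using 5(2) by (simp add: acc'_def)
    show "s\<^sub>5 x = s x" if "N \<le> x" "x \<notin> {0, a, l, r}" for x
      using that 5(3) 2(4) by (simp add: s\<^sub>4_def s\<^sub>1_def)
    have "1 + expr_cost (IsNode (Var l)) s + (1 + (1 + expr_cost ?pair s) + (1 + t\<^sub>2 +
        (1 + (1 + bit_size acc') + (1 + (bit_size (Node e xs) + bit_size xs))))) \<le> ?K"
      using t\<^sub>0 t\<^sub>1 t\<^sub>2 size acc acc' by simp
    with 5(4) show "1 + expr_cost (IsNode (Var l)) s + (1 + (1 + expr_cost ?pair s) + (1 + t\<^sub>2 +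
        (1 + (1 + bit_size acc') + (1 + (bit_size (Node e xs) + bit_size xs))))) + t\<^sub>5
        \<le> (vlength (Node e xs) + 1) * ?K"
      by (simp only: vlength.simps add_Suc mult_Suc)
  qed
qed

lemma polytime_vfold_aux:
  assumes "polytime S"
    and grow: "\<And>x e acc. bit_size (S (Node x (Node e acc))) \<le> bit_size acc + poly q (bit_size x + bit_size e)"
  shows "polytime (\<lambda>y. vfold (\<lambda>e acc. S (Node (val_left y) (Node e acc)))
    (val_left (val_right y)) (val_right (val_right y)))"
proof -
  obtain c N p where S: "computes c N p S"
    using assms by (auto simp: polytime_def)
  define a where "a = Suc N"
  define l where "l = Suc a"
  define r where "r = Suc l"
  have vars: "N \<le> a" "N \<le> l" "N \<le> r" "distinct [0, a, l, r]" "a < Suc r" "l < Suc r"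
    by (auto simp: a_def l_def r_def)
  define loop where "loop = While (IsNode (Var l))
    (Seq (Assign 0 (MkNode (Var a) (MkNode (Left (Var l)) (Var r))))
      (Seq c (Seq (Assign r (Var 0)) (Assign l (Right (Var l))))))"
  define c' where "c' = Seq (Assign a (Left (Var 0))) (Seq (Assign l (Left (Right (Var 0))))
    (Seq (Assign r (Right (Right (Var 0)))) (Seq loop (Assign 0 (Var r)))))"
  \<comment> \<open>The initial accumulator, and at most \<open>n\<close> rounds that add at most
    \<open>poly q (2 * n)\<close> each, where \<open>n\<close> is the input size: context and
    element have size at most \<open>n\<close>.\<close>
  define B where "B = [:0, 1:] + [:0, 1:] * pcompose q [:0, 2:]"
  define p' where "p' = [:20, 20:] + B + [:1, 1:] * ([:20:] + smult 20 B + pcompose p ([:2:] + smult 3 B))"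
  let ?F = "\<lambda>y. vfold (\<lambda>e acc. S (Node (val_left y) (Node e acc)))
    (val_left (val_right y)) (val_right (val_right y))"
  have "computes c' (Suc r) p' ?F"
    unfolding computes_def
  proof (intro allI)
    fix f and s :: state
    define y where "y = s 0"
    let ?n = "bit_size y"
    let ?l = "val_left (val_right y)" and ?acc = "val_right (val_right y)"
    have le: "bit_size (val_left y) \<le> ?n" "bit_size (val_right y) \<le> ?n" "bit_size ?l \<le> ?n"
      "bit_size ?acc \<le> ?n"
      using bit_size_val_left bit_size_val_right le_trans by metis+
    define s\<^sub>1 where "s\<^sub>1 = s(a := val_left y)"
    define s\<^sub>2 where "s\<^sub>2 = s\<^sub>1(l := ?l)"
    define s\<^sub>3 where "s\<^sub>3 = s\<^sub>2(r := ?acc)"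
    have zero: "s\<^sub>1 0 = y" "s\<^sub>2 0 = y"
      using vars by (auto simp: s\<^sub>2_def s\<^sub>1_def y_def)
    have e\<^sub>1: "exec f (Assign a (Left (Var 0))) s (1 + (?n + bit_size (val_left y))) s\<^sub>1"
      using exec_Assign[of f a "Left (Var 0)" s] by (simp add: s\<^sub>1_def y_def)
    have e\<^sub>2: "exec f (Assign l (Left (Right (Var 0)))) s\<^sub>1
        (1 + (?n + bit_size (val_right y) + bit_size ?l)) s\<^sub>2"
      using exec_Assign[of f l "Left (Right (Var 0))" s\<^sub>1] zero by (simp add: s\<^sub>2_def)
    have e\<^sub>3: "exec f (Assign r (Right (Right (Var 0)))) s\<^sub>2
        (1 + (?n + bit_size (val_right y) + bit_size ?acc)) s\<^sub>3"
      using exec_Assign[of f r "Right (Right (Var 0))" s\<^sub>2] zero by (simp add: s\<^sub>3_def)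
    let ?d = "poly q (2 * ?n)" and ?B = "?n + ?n * poly q (2 * ?n)"
    have grow': "bit_size (S (Node (val_left y) (Node e acc))) \<le> bit_size acc + ?d"
      if "bit_size e \<le> ?n" for e acc
    proof -
      have "poly q (bit_size (val_left y) + bit_size e) \<le> ?d"
        using that le by (intro poly_nat_mono) simp
      with grow[of "val_left y" e acc] show ?thesis
        by simp
    qed
    have len: "vlength ?l \<le> ?n"
      using vlength_less_bit_size[of ?l] le by simp
    then have "vlength ?l * ?d \<le> ?n * ?d"
      by (rule mult_right_mono) simp
    then have accB: "bit_size ?acc + vlength ?l * ?d \<le> ?B"
      using le(4) by linarith
    have init: "s\<^sub>3 a = val_left y" "s\<^sub>3 l = ?l" "s\<^sub>3 r = ?acc"
      using vars by (auto simp: s\<^sub>3_def s\<^sub>2_def s\<^sub>1_def)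
    obtain t\<^sub>4 s\<^sub>4 where 4: "exec f loop s\<^sub>3 t\<^sub>4 s\<^sub>4" "s\<^sub>4 r = ?F y"
      "\<And>x. N \<le> x \<Longrightarrow> x \<notin> {0, a, l, r} \<Longrightarrow> s\<^sub>4 x = s\<^sub>3 x"
      "t\<^sub>4 \<le> (vlength ?l + 1) * (20 + 20 * ?B + poly p (2 + 3 * ?B))"
      using exec_fold_loop[OF S vars(1-4) grow' init le(3) _ _ accB, of f, folded loop_def] le(1)
      by auto
    have e\<^sub>5: "exec f (Assign 0 (Var r)) s\<^sub>4 (1 + bit_size (?F y)) (s\<^sub>4(0 := ?F y))"
      using exec_Assign[of f 0 "Var r" s\<^sub>4] 4(2) by simp
    have "bit_size (?F y) \<le> bit_size ?acc + vlength ?l * ?d"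
      by (rule bit_size_vfold) (use grow' le in auto)
    then have "bit_size (?F y) \<le> ?B"
      using accB by simp
    moreover have "t\<^sub>4 \<le> (?n + 1) * (20 + 20 * ?B + poly p (2 + 3 * ?B))"
      using 4(4) by (rule order_trans) (use len in \<open>intro mult_right_mono, auto\<close>)
    ultimately have time: "1 + (1 + (?n + bit_size (val_left y))) + (1 +
        (1 + (?n + bit_size (val_right y) + bit_size ?l)) + (1 +
        (1 + (?n + bit_size (val_right y) + bit_size ?acc)) + (1 + t\<^sub>4 + (1 + bit_size (?F y)))))
        \<le> 20 + 20 * ?n + ?B + (?n + 1) * (20 + 20 * ?B + poly p (2 + 3 * ?B))"
      using le by linarith
    note run = exec_Seq[OF e\<^sub>1 exec_Seq[OF e\<^sub>2 exec_Seq[OF e\<^sub>3 exec_Seq[OF 4(1) e\<^sub>5]]]]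
    have B: "poly B ?n = ?B"
      by (simp add: B_def poly_pcompose mult.commute)
    have p': "poly p' ?n = 20 + 20 * ?n + ?B + (?n + 1) * (20 + 20 * ?B + poly p (2 + 3 * ?B))"
      unfolding p'_def by (simp add: poly_pcompose B mult.commute algebra_simps)
    show "\<exists>t s'. exec f c' s t s' \<and> t \<le> poly p' (bit_size (s 0)) \<and>
        s' 0 = ?F (s 0) \<and> (\<forall>x\<ge>Suc r. s' x = s x)"
    proof (intro exI conjI allI impI, rule run[folded c'_def])
      show "(s\<^sub>4(0 := ?F y)) x = s x" if "Suc r \<le> x" for x
        using that vars 4(3)[of x] by (simp add: s\<^sub>3_def s\<^sub>2_def s\<^sub>1_def)
      show "(s\<^sub>4(0 := ?F y)) 0 = ?F (s 0)"
        by (simp add: y_def)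
    qed (use time p' in \<open>simp only: y_def\<close>)
  qed
  then show ?thesis
    by (auto simp: polytime_def)
qed

section \<open>Arithmetic and closure properties\<close>

definition vadd :: "val \<Rightarrow> val \<Rightarrow> val" where
  "vadd x y = Leaf (val_int x + val_int y)"

definition vsub :: "val \<Rightarrow> val \<Rightarrow> val" where
  "vsub x y = Leaf (val_int x - val_int y)"

definition vle :: "val \<Rightarrow> val \<Rightarrow> val" where
  "vle x y = val_bool (val_int x \<le> val_int y)"

lemma bit_size_vadd: "bit_size (vadd x y) \<le> bit_size x + bit_size y"
  using bit_size_Leaf_add[of "val_int x" "val_int y"] bit_size_val_int[of x] bit_size_val_int[of y]
  unfolding vadd_def by linarith

lemma bit_size_vsub: "bit_size (vsub x y) \<le> bit_size x + bit_size y"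
  using bit_size_Leaf_add[of "val_int x" "- val_int y"] bit_size_val_int[of x] bit_size_val_int[of y]
  unfolding vsub_def by simp

lemma polytime_id: "polytime (\<lambda>x. x)"
  by (rule polytime_expr[of "Var 0" _ 1]) auto

lemma polytime_const: "polytime (\<lambda>x. Leaf i)"
proof (rule polytime_expr[of "Const i"])
  show "expr_cost (Const i) s \<le> bit_size (Leaf i) * bit_size (s 0)" for s
    using bit_size_pos[of "s 0"] by (cases "bit_size (s 0)") auto
qed simp

lemma polytime_val_left: "polytime F \<Longrightarrow> polytime (\<lambda>x. val_left (F x))"
proof (rule polytime_comp[of val_left])
  show "polytime val_left"
  proof (rule polytime_expr[of "Left (Var 0)" _ 2])
    show "expr_cost (Left (Var 0)) s \<le> 2 * bit_size (s 0)" for s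
      using bit_size_val_left[of "s 0"] by simp
  qed simp
qed

lemma polytime_val_right: "polytime F \<Longrightarrow> polytime (\<lambda>x. val_right (F x))"
proof (rule polytime_comp[of val_right])
  show "polytime val_right"
  proof (rule polytime_expr[of "Right (Var 0)" _ 2])
    show "expr_cost (Right (Var 0)) s \<le> 2 * bit_size (s 0)" for s
      using bit_size_val_right[of "s 0"] by simp
  qed simp
qed

lemma polytime_binop:
  assumes "polytime F" "polytime G" "polytime (\<lambda>y. h (val_left y) (val_right y))"
  shows "polytime (\<lambda>x. h (F x) (G x))"
  using polytime_comp[OF assms(3) polytime_Node[OF assms(1,2)]] by simp

lemma polytime_vadd: "polytime F \<Longrightarrow> polytime G \<Longrightarrow> polytime (\<lambda>x. vadd (F x) (G x))"
proof (erule (1) polytime_binop, rule polytime_expr)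
  let ?e = "Plus (Left (Var 0)) (Right (Var 0))"
  show "eval_expr ?e s = vadd (val_left (s 0)) (val_right (s 0))" for s
    by (simp add: vadd_def)
  show "expr_cost ?e s \<le> 6 * bit_size (s 0)" for s
    using bit_size_vadd[of "val_left (s 0)" "val_right (s 0)"] bit_size_val_left[of "s 0"]
      bit_size_val_right[of "s 0"] by (simp add: vadd_def)
qed

lemma polytime_vsub: "polytime F \<Longrightarrow> polytime G \<Longrightarrow> polytime (\<lambda>x. vsub (F x) (G x))"
proof (erule (1) polytime_binop, rule polytime_expr)
  let ?e = "Minus (Left (Var 0)) (Right (Var 0))"
  show "eval_expr ?e s = vsub (val_left (s 0)) (val_right (s 0))" for s
    by (simp add: vsub_def)
  show "expr_cost ?e s \<le> 6 * bit_size (s 0)" for s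
    using bit_size_vsub[of "val_left (s 0)" "val_right (s 0)"] bit_size_val_left[of "s 0"]
      bit_size_val_right[of "s 0"] by (simp add: vsub_def)
qed

lemma polytime_vle: "polytime F \<Longrightarrow> polytime G \<Longrightarrow> polytime (\<lambda>x. vle (F x) (G x))"
proof (erule (1) polytime_binop, rule polytime_expr)
  let ?e = "Leq (Left (Var 0)) (Right (Var 0))"
  show "eval_expr ?e s = vle (val_left (s 0)) (val_right (s 0))" for s
    by (simp add: vle_def)
  show "expr_cost ?e s \<le> 6 * bit_size (s 0)" for s
    using bit_size_val_bool[of "val_int (val_left (s 0)) \<le> val_int (val_right (s 0))"]
      bit_size_val_left[of "s 0"] bit_size_val_right[of "s 0"] bit_size_pos[of "s 0"] by simp
qed

text \<open>A polynomial-time step alone would not suffice, since a step that doubles the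
  accumulator makes it exponentially large. Hence \<open>grow\<close>, where the increment is
  bounded in terms of context and element only.\<close>

lemma polytime_vfold:
  assumes "polytime L" "polytime I"
    and S: "polytime (\<lambda>y. S (val_left y) (val_left (val_right y)) (val_right (val_right y)))"
    and grow: "\<And>x e acc. bit_size (S x e acc) \<le> bit_size acc + poly q (bit_size x + bit_size e)"
  shows "polytime (\<lambda>x. vfold (S x) (L x) (I x))"
proof -
  have "polytime (\<lambda>y. vfold (\<lambda>e acc. S (val_left y) e acc)
      (val_left (val_right y)) (val_right (val_right y)))"
    using polytime_vfold_aux[OF S, of q] grow by simp
  from polytime_comp[OF this polytime_Node[OF polytime_id polytime_Node[OF assms(1,2)]]]
  show ?thesis
    by simp
qed

lemmas polytime_intros = polytime_const polytime_id polytime_Node polytime_If polytime_val_left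
  polytime_val_right polytime_vadd polytime_vsub polytime_vle


section \<open>The reduction as a function on binary trees\<close>

definition veq :: "val \<Rightarrow> val \<Rightarrow> val" where
  "veq x y = (if vle x y = Leaf 0 then Leaf 0 else vle y x)"

definition vnot :: "val \<Rightarrow> val" where
  "vnot x = (if x = Leaf 0 then Leaf 1 else Leaf 0)"

definition vabs :: "val \<Rightarrow> val" where
  "vabs x = (if vle (Leaf 0) x = Leaf 0 then vsub (Leaf 0) x else x)"

definition vrev :: "val \<Rightarrow> val" where
  "vrev l = vfold Node l (Leaf 0)"

definition vtotal :: "val \<Rightarrow> val" where
  "vtotal es = vfold (\<lambda>e acc. vadd acc (vabs (val_right e))) es (Leaf 0)"

definition vlookup :: "val \<Rightarrow> val \<Rightarrow> val \<Rightarrow> val \<Rightarrow> val" where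
  "vlookup u v d es = vfold (\<lambda>e acc. if veq u (val_left (val_left e)) = Leaf 0 then acc
     else if veq v (val_right (val_left e)) = Leaf 0 then acc else val_right e) es d"

definition vmove :: "val \<Rightarrow> val \<Rightarrow> val \<Rightarrow> val \<Rightarrow> val \<Rightarrow> val" where
  "vmove own u v d es =
     (if own = Leaf 0 then if veq u v = Leaf 0 then d else Leaf 0 else vlookup u v d es)"

definition vpenalty_alice :: "val \<Rightarrow> val" where
  "vpenalty_alice es = (let t = vtotal es in vadd (vadd t t) (Leaf 1))"

definition vpenalty_bob :: "val \<Rightarrow> val" where
  "vpenalty_bob es = (let t = vtotal es in vadd (vadd (vadd t t) (vadd t t)) (Leaf 1))"

definition valice_copy :: "val \<Rightarrow> val" where
  "valice_copy u = vadd u u"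

definition vbob_copy :: "val \<Rightarrow> val" where
  "vbob_copy u = vadd (vadd u u) (Leaf 1)"

definition valice_arc :: "val \<Rightarrow> val \<Rightarrow> val \<Rightarrow> val" where
  "valice_arc x a b = Node (Node (valice_copy (val_left a)) (vbob_copy (val_left b)))
     (vmove (val_right a) (val_left a) (val_left b)
       (vsub (Leaf 0) (vpenalty_alice (val_right x))) (val_right x))"

definition vbob_arc :: "val \<Rightarrow> val \<Rightarrow> val \<Rightarrow> val" where
  "vbob_arc x a b = Node (Node (vbob_copy (val_left a)) (valice_copy (val_left b)))
     (vmove (vnot (val_right a)) (val_left a) (val_left b)
       (vpenalty_bob (val_right x)) (val_right x))"

definition varcs :: "val \<Rightarrow> val" where
  "varcs x = vfold (\<lambda>a acc. vfold (\<lambda>b acc. Node (valice_arc x a b) (Node (vbob_arc x a b) acc))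
     (val_left x) acc) (val_left x) (Leaf 0)"

text \<open>The fold prepends, so the list is reversed beforehand: \<open>vanswer\<close> relies on
  the order of the nodes, whereas the arcs may come in any order.\<close>

definition vnodes :: "val \<Rightarrow> val" where
  "vnodes x = vfold (\<lambda>a acc. Node (Node (valice_copy (val_left a)) (Leaf 1))
     (Node (Node (vbob_copy (val_left a)) (Leaf 0)) acc)) (vrev (val_left x)) (Leaf 0)"

definition vquery :: "val \<Rightarrow> val" where
  "vquery x = Node (vnodes x) (varcs x)"

text \<open>An infinite energy is encoded as \<open>Leaf (- 1)\<close>; it passes the comparison
  with a nonnegative threshold and remains as it is.\<close>

definition vtruncate :: "val \<Rightarrow> val \<Rightarrow> val" where
  "vtruncate t e = (if vle e t = Leaf 0 then Leaf (- 1) else e)"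

text \<open>The answer to the query lists the energies of \<open>2 * u\<close> and \<open>2 * u + 1\<close> for each
  node \<open>u\<close> in turn; the accumulator consists of the part not yet consumed and of the output.\<close>

definition vanswer :: "val \<Rightarrow> val" where
  "vanswer z = vrev (val_right (vfold
     (\<lambda>a acc. Node (val_right (val_right (val_left acc)))
        (Node (vtruncate (vtotal (val_right (val_left z))) (val_left (val_left acc))) (val_right acc)))
     (val_left (val_left z)) (Node (val_right z) (Leaf 0))))"

section \<open>Polynomial running time of the reduction\<close>

lemma polytime_veq: "polytime F \<Longrightarrow> polytime G \<Longrightarrow> polytime (\<lambda>x. veq (F x) (G x))"
  unfolding veq_def by (intro polytime_intros)

lemma polytime_vnot: "polytime F \<Longrightarrow> polytime (\<lambda>x. vnot (F x))"
  unfolding vnot_def by (intro polytime_intros)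

lemma polytime_vabs: "polytime F \<Longrightarrow> polytime (\<lambda>x. vabs (F x))"
  unfolding vabs_def by (intro polytime_intros)

lemma polytime_ctx: "polytime F \<Longrightarrow> polytime (\<lambda>y. F (val_left y))"
  by (rule polytime_comp[OF _ polytime_val_left[OF polytime_id]])

lemma polytime_vrev: "polytime F \<Longrightarrow> polytime (\<lambda>x. vrev (F x))"
  unfolding vrev_def
  by (rule polytime_vfold[where q = "[:1, 1:]"]) (auto intro!: polytime_intros)

lemma bit_size_vabs: "bit_size (vabs x) \<le> bit_size x + 1"
  using bit_size_vsub[of "Leaf 0" x] by (simp add: vabs_def floorlog_def)

lemma polytime_vtotal:
  assumes "polytime F"
  shows "polytime (\<lambda>x. vtotal (F x))"
  unfolding vtotal_def
proof (rule polytime_vfold[where q = "[:1, 1:]"])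
  show "bit_size (vadd acc (vabs (val_right e))) \<le>
      bit_size acc + poly [:1, 1:] (bit_size x + bit_size e)" for x e acc :: val
    using bit_size_vadd[of acc "vabs (val_right e)"] bit_size_vabs[of "val_right e"]
      bit_size_val_right[of e] by simp
qed (intro assms polytime_intros polytime_vabs)+

lemma polytime_vlookup:
  assumes "polytime U" "polytime V" "polytime D" "polytime F"
  shows "polytime (\<lambda>x. vlookup (U x) (V x) (D x) (F x))"
  unfolding vlookup_def
proof (rule polytime_vfold[where q = "[:0, 1:]"])
  show "bit_size (if veq (U x) (val_left (val_left e)) = Leaf 0 then acc
     else if veq (V x) (val_right (val_left e)) = Leaf 0 then acc else val_right e) \<le>
     bit_size acc + poly [:0, 1:] (bit_size x + bit_size e)" for x e acc
    using bit_size_val_right[of e] by simp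
qed (intro assms polytime_intros polytime_veq polytime_ctx)+

lemma polytime_vmove:
  assumes "polytime P" "polytime U" "polytime V" "polytime D" "polytime F"
  shows "polytime (\<lambda>x. vmove (P x) (U x) (V x) (D x) (F x))"
  unfolding vmove_def by (intro assms polytime_intros polytime_veq polytime_vlookup)

lemma polytime_valice_arc:
  assumes "polytime X" "polytime A" "polytime B"
  shows "polytime (\<lambda>x. valice_arc (X x) (A x) (B x))"
  unfolding valice_arc_def valice_copy_def vbob_copy_def vpenalty_alice_def Let_def
  by (intro assms polytime_intros polytime_vmove polytime_vtotal)

lemma polytime_vbob_arc:
  assumes "polytime X" "polytime A" "polytime B"
  shows "polytime (\<lambda>x. vbob_arc (X x) (A x) (B x))"
  unfolding vbob_arc_def valice_copy_def vbob_copy_def vpenalty_bob_def Let_def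
  by (intro assms polytime_intros polytime_vmove polytime_vtotal polytime_vnot)

text \<open>The two arcs are a polynomial-time function of the packed arguments, and this already
  bounds their size polynomially, without any computation.\<close>

lemma bit_size_arcs:
  obtains q :: "nat poly" where "\<And>x a b acc.
    bit_size (Node (valice_arc x a b) (Node (vbob_arc x a b) acc)) \<le>
      bit_size acc + poly q (bit_size x + bit_size a + bit_size b)"
proof -
  have "polytime (\<lambda>y. Node (valice_arc (val_left y) (val_left (val_right y)) (val_right (val_right y)))
      (vbob_arc (val_left y) (val_left (val_right y)) (val_right (val_right y))))"
    by (intro polytime_intros polytime_valice_arc polytime_vbob_arc)
  then obtain q :: "nat poly" where q: "\<And>y.
    bit_size (Node (valice_arc (val_left y) (val_left (val_right y)) (val_right (val_right y)))
      (vbob_arc (val_left y) (val_left (val_right y)) (val_right (val_right y))))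
      \<le> poly q (bit_size y)"
    using polytime_bit_size by blast
  have "bit_size (Node (valice_arc x a b) (Node (vbob_arc x a b) acc)) \<le>
      bit_size acc + poly (1 + pcompose q [:2, 1:]) (bit_size x + bit_size a + bit_size b)"
    for x a b acc
    using q[of "Node x (Node a b)"] by (simp add: poly_pcompose ac_simps)
  then show thesis
    by (rule that)
qed

lemma polytime_varcs: "polytime varcs"
proof -
  obtain q :: "nat poly" where q: "\<And>x a b acc.
    bit_size (Node (valice_arc x a b) (Node (vbob_arc x a b) acc)) \<le>
      bit_size acc + poly q (bit_size x + bit_size a + bit_size b)"
    using bit_size_arcs by metis
  \<comment> \<open>The context \<open>y\<close> contains the accumulator of the outer fold, so the
    growth bound used here is of no help for the outer fold, whose bound is derived
    separately.\<close>
  have inner: "polytime (\<lambda>y. vfold (\<lambda>b acc. Node (valice_arc (val_left y) (val_left (val_right y)) b)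
      (Node (vbob_arc (val_left y) (val_left (val_right y)) b) acc))
      (val_left (val_left y)) (val_right (val_right y)))"
  proof (rule polytime_vfold[where q = "pcompose q [:0, 2:]"])
    fix y b acc
    have le: "bit_size (val_left y) + bit_size (val_left (val_right y)) \<le> 2 * bit_size y"
      using bit_size_val_left[of y] bit_size_val_left[of "val_right y"] bit_size_val_right[of y]
      by linarith
    then have "poly q (bit_size (val_left y) + bit_size (val_left (val_right y)) + bit_size b) \<le>
        poly (pcompose q [:0, 2:]) (bit_size y + bit_size b)"
      unfolding poly_pcompose by (intro poly_nat_mono) simp
    with q[of "val_left y" "val_left (val_right y)" b acc]
    show "bit_size (Node (valice_arc (val_left y) (val_left (val_right y)) b)
      (Node (vbob_arc (val_left y) (val_left (val_right y)) b) acc)) \<le> bit_size acc +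
      poly (pcompose q [:0, 2:]) (bit_size y + bit_size b)"
      by linarith
  qed (intro polytime_intros polytime_valice_arc polytime_vbob_arc)+
  have "polytime (\<lambda>x. varcs x)"
    unfolding varcs_def
  \<comment> \<open>The number of inner rounds times the growth per round; the factor 2 arises
    because the inner element \<open>b\<close> is a part of \<open>x\<close>.\<close>
  proof (rule polytime_vfold[where q = "[:0, 1:] * pcompose q [:0, 2:]"])
    fix x a acc
    let ?d = "poly q (2 * (bit_size x + bit_size a))"
    have "bit_size (vfold (\<lambda>b acc. Node (valice_arc x a b) (Node (vbob_arc x a b) acc))
        (val_left x) acc) \<le> bit_size acc + vlength (val_left x) * ?d"
    proof (rule bit_size_vfold)
      fix b acc assume "bit_size b \<le> bit_size (val_left x)"
      then have "poly q (bit_size x + bit_size a + bit_size b) \<le> ?d"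
        using bit_size_val_left[of x] by (intro poly_nat_mono) simp
      with q[of x a b acc]
      show "bit_size (Node (valice_arc x a b) (Node (vbob_arc x a b) acc)) \<le> bit_size acc + ?d"
        by linarith
    qed
    also have "vlength (val_left x) \<le> bit_size x + bit_size a"
      using vlength_less_bit_size[of "val_left x"] bit_size_val_left[of x] by linarith
    finally show "bit_size (vfold (\<lambda>b acc. Node (valice_arc x a b) (Node (vbob_arc x a b) acc))
        (val_left x) acc) \<le> bit_size acc +
        poly ([:0, 1:] * pcompose q [:0, 2:]) (bit_size x + bit_size a)"
      by (simp add: poly_pcompose mult.commute)
  qed (intro inner polytime_intros)+
  then show ?thesis
    by simp
qed

lemma polytime_vnodes: "polytime vnodes"
proof -
  have "polytime (\<lambda>x. vnodes x)"
    unfolding vnodes_def valice_copy_def vbob_copy_def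
  proof (rule polytime_vfold[where q = "[:20, 20:]"])
    fix x e acc
    note * = bit_size_vadd[of "val_left e" "val_left e"] bit_size_val_left[of e]
      bit_size_vadd[of "vadd (val_left e) (val_left e)" "Leaf 1"]
    have "bit_size (Leaf 1) = 2" "bit_size (Leaf 0) = 1"
      by (simp_all add: floorlog_def)
    with * show "bit_size (Node (Node (vadd (val_left e) (val_left e)) (Leaf 1))
        (Node (Node (vadd (vadd (val_left e) (val_left e)) (Leaf 1)) (Leaf 0)) acc))
        \<le> bit_size acc + poly [:20, 20:] (bit_size x + bit_size e)" for x
      by (simp del: bit_size.simps(1))
  qed (intro polytime_intros polytime_vrev)+
  then show ?thesis
    by simp
qed

lemma polytime_vquery: "polytime vquery"
proof -
  have "polytime (\<lambda>x. vquery x)"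
    unfolding vquery_def by (intro polytime_Node polytime_vnodes polytime_varcs)
  then show ?thesis
    by simp
qed

lemma polytime_vanswer: "polytime vanswer"
proof -
  have "polytime (\<lambda>z. vanswer z)"
    unfolding vanswer_def
  proof (intro polytime_vrev polytime_val_right, rule polytime_vfold[where q = "[:20:]"])
    fix z a acc :: val
    \<comment> \<open>The energy taken from the unread part moves to the output, so the accumulator
      grows only by a constant. The unit covers the \<open>Leaf 0\<close> obtained when nothing is
      left.\<close>
    have pop: "bit_size (val_right (val_right v)) + bit_size (val_left v) \<le> bit_size v + 1" for v
    proof (cases v)
      case (Node b c)
      then show ?thesis
        using bit_size_val_right[of c] by simp
    qed (simp add: floorlog_def)
    have trunc: "bit_size (vtruncate t e) \<le> bit_size e + 2" for t e
      by (simp add: vtruncate_def floorlog_def)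
    have acc: "bit_size (val_left acc) + bit_size (val_right acc) \<le> bit_size acc + 1"
      by (cases acc) (auto simp: floorlog_def)
    show "bit_size (Node (val_right (val_right (val_left acc)))
        (Node (vtruncate (vtotal (val_right (val_left z))) (val_left (val_left acc))) (val_right acc)))
        \<le> bit_size acc + poly [:20:] (bit_size z + bit_size a)"
      using pop[of "val_left acc"] acc
        trunc[of "vtotal (val_right (val_left z))" "val_left (val_left acc)"] by simp
  next
    show "polytime (\<lambda>y. Node (val_right (val_right (val_left (val_right (val_right y)))))
        (Node (vtruncate (vtotal (val_right (val_left (val_left y))))
          (val_left (val_left (val_right (val_right y))))) (val_right (val_right (val_right y)))))"
      unfolding vtruncate_def by (intro polytime_intros polytime_vtotal)
  qed (intro polytime_intros)+
  then show ?thesis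
    by simp
qed


section \<open>Encodings\<close>

lemma encode_list_simps [simp]:
  "encode_list enc [] = Leaf 0"
  "encode_list enc (x # xs) = Node (enc x) (encode_list enc xs)"
  by (simp_all add: encode_list_def)

lemma encode_list_eq_iff: "encode_list enc xs = encode_list enc' ys \<longleftrightarrow> map enc xs = map enc' ys"
proof (induction xs arbitrary: ys)
  case Nil
  show ?case by (cases ys) auto
next
  case (Cons x xs)
  then show ?case by (cases ys) auto
qed

lemma val_bool_simps [simp]:
  "val_bool True = Leaf 1" "val_bool False = Leaf 0" "val_bool b = Leaf 0 \<longleftrightarrow> \<not> b"
  "val_bool a = val_bool b \<longleftrightarrow> a = b"
  by (auto simp: val_bool_def)

lemma vfold_encode_list:
  assumes "\<And>x ys. x \<in> set xs \<Longrightarrow> g (enc x) (encode_list enc' ys) = encode_list enc' (h x @ ys)"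
  shows "vfold g (encode_list enc xs) (encode_list enc' ys) =
    encode_list enc' (concat (map h (rev xs)) @ ys)"
  using assms by (induction xs arbitrary: ys) auto

lemma vrev_encode_list: "vrev (encode_list enc xs) = encode_list enc (rev xs)"
  using vfold_encode_list[of xs Node enc enc "\<lambda>x. [x]" "[]"] by (simp add: vrev_def)

abbreviation encode_arc :: "(nat \<times> nat \<Rightarrow> int) \<Rightarrow> nat \<times> nat \<Rightarrow> val" where
  "encode_arc w \<equiv> \<lambda>(u, v). Node (Node (Leaf (int u)) (Leaf (int v))) (Leaf (w (u, v)))"

lemma veq_Leaf [simp]: "veq (Leaf i) (Leaf j) = val_bool (i = j)"
  by (auto simp: veq_def vle_def)

lemma vtotal_encode_list: "vtotal (encode_list (encode_arc w) es) = Leaf (\<Sum>e\<leftarrow>es. \<bar>w e\<bar>)"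
proof -
  have "vfold (\<lambda>e acc. vadd acc (vabs (val_right e))) (encode_list (encode_arc w) es) (Leaf i) =
      Leaf (i + (\<Sum>e\<leftarrow>es. \<bar>w e\<bar>))" for i
  proof (induction es arbitrary: i)
    case (Cons e es)
    have "vadd (Leaf i) (vabs (val_right (encode_arc w e))) = Leaf (i + \<bar>w e\<bar>)"
      by (cases e) (simp add: vadd_def vabs_def vle_def vsub_def)
    with Cons show ?case
      by (simp add: add.assoc)
  qed simp
  from this[of 0] show ?thesis
    by (simp add: vtotal_def)
qed

lemma vlookup_encode_list:
  "vlookup (Leaf (int u)) (Leaf (int v)) d (encode_list (encode_arc w) es) =
    (if (u, v) \<in> set es then Leaf (w (u, v)) else d)"
  unfolding vlookup_def by (induction es arbitrary: d) auto

lemma vmove_encode_list: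
  assumes "set es = parcs (arena G)"
  shows "vmove (val_bool own) (Leaf (int u)) (Leaf (int v)) (Leaf d) (encode_list (encode_arc w) es) =
    Leaf (move_weight G w own u v d)"
  using assms by (simp add: vmove_def move_weight_def vlookup_encode_list)

lemma encode_game_def':
  "encode_game G w ns es =
     Node (encode_list (\<lambda>u. Node (Leaf (int u)) (val_bool (u \<in> alice G))) ns)
       (encode_list (encode_arc w) es)"
  by (simp add: encode_game_def)

definition valid_instance ::
    "nat game_graph \<Rightarrow> nat list \<Rightarrow> (nat \<times> nat) list \<Rightarrow> bool" where
  "valid_instance G ns es \<longleftrightarrow> game_graph G \<and>
     distinct ns \<and> set ns = pverts (arena G) \<and> distinct es \<and> set es = parcs (arena G)"

lemma vtotal_instance:
  assumes "valid_instance G ns es"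
  shows "vtotal (encode_list (encode_arc w) es) = Leaf (total_weight G w)"
  using assms
  by (simp add: vtotal_encode_list total_weight_def valid_instance_def sum_list_distinct_conv_sum_set)

definition biclique_nodes :: "nat list \<Rightarrow> nat list" where
  "biclique_nodes ns = concat (map (\<lambda>u. [2 * u, 2 * u + 1]) ns)"

definition biclique_arcs :: "nat list \<Rightarrow> (nat \<times> nat) list" where
  "biclique_arcs ns = concat (map (\<lambda>u. concat (map (\<lambda>v. [(2 * u, 2 * v + 1), (2 * u + 1, 2 * v)])
     (rev ns))) (rev ns))"

lemma distinct_concat_map:
  assumes "distinct xs" "\<And>x. x \<in> set xs \<Longrightarrow> distinct (h x)"
    and "\<And>x y. x \<in> set xs \<Longrightarrow> y \<in> set xs \<Longrightarrow> x \<noteq> y \<Longrightarrow> set (h x) \<inter> set (h y) = {}"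
  shows "distinct (concat (map h xs))"
  using assms by (induction xs) auto

lemma double_neq_Suc_double [simp]: "2 * u \<noteq> Suc (2 * v)" "Suc (2 * v) \<noteq> 2 * (u::nat)"
  by presburger+

lemma valid_instance_biclique:
  assumes "valid_instance G ns es"
  shows "valid_instance (biclique G) (biclique_nodes ns) (biclique_arcs ns)"
proof -
  have ns: "distinct ns" "set ns = pverts (arena G)" "game_graph G"
    using assms by (auto simp: valid_instance_def)
  have "distinct (biclique_nodes ns)"
    unfolding biclique_nodes_def using ns by (intro distinct_concat_map) auto
  moreover have "set (biclique_nodes ns) = pverts (arena (biclique G))"
    using ns by (auto simp: biclique_nodes_def biclique_simps)
  moreover have "distinct (biclique_arcs ns)"
    unfolding biclique_arcs_def using ns by (intro distinct_concat_map) auto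
  moreover have "set (biclique_arcs ns) = parcs (arena (biclique G))"
    using ns by (auto simp: biclique_arcs_def biclique_simps)
  ultimately show ?thesis
    using game_graph_biclique[OF ns(3)] by (simp add: valid_instance_def)
qed

lemma copies_Leaf:
  "valice_copy (Leaf (int u)) = Leaf (int (2 * u))"
  "vbob_copy (Leaf (int u)) = Leaf (int (2 * u + 1))"
  by (simp_all add: valice_copy_def vbob_copy_def vadd_def)

lemma vnot_val_bool: "vnot (val_bool b) = val_bool (\<not> b)"
  by (simp add: vnot_def)

lemma vquery_encode_game:
  assumes inst: "valid_instance G ns es"
  shows "vquery (encode_game G w ns es) =
    encode_game (biclique G) (biclique_weight G w) (biclique_nodes ns) (biclique_arcs ns)"
proof -
  let ?x = "encode_game G w ns es" and ?H = "biclique G" and ?W = "biclique_weight G w"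
  let ?enc = "\<lambda>u. Node (Leaf (int u)) (val_bool (u \<in> alice G))"
  let ?enc' = "\<lambda>u. Node (Leaf (int u)) (val_bool (u \<in> alice ?H))"
  have V: "set ns = pverts (arena G)"
    using inst by (simp add: valid_instance_def)
  have "vnodes ?x = encode_list ?enc' (concat (map (\<lambda>u. [2 * u, 2 * u + 1]) (rev (rev ns))) @ [])"
    unfolding vnodes_def encode_game_def' val_left.simps vrev_encode_list encode_list_simps(1)[symmetric, of ?enc']
    by (rule vfold_encode_list)
      (auto simp: copies_Leaf biclique_simps(2) V image_iff)
  then have nodes: "vnodes ?x = encode_list ?enc' (biclique_nodes ns)"
    by (simp add: biclique_nodes_def)
  have pen: "vsub (Leaf 0) (vpenalty_alice (encode_list (encode_arc w) es)) = Leaf (- alice_penalty G w)"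
    "vpenalty_bob (encode_list (encode_arc w) es) = Leaf (bob_penalty G w)"
    by (simp_all add: vpenalty_alice_def vpenalty_bob_def vtotal_instance[OF inst] vadd_def vsub_def
        alice_penalty_def bob_penalty_def)
  have move: "vmove (val_bool own) (Leaf (int u)) (Leaf (int v)) (Leaf d)
      (encode_list (encode_arc w) es) = Leaf (move_weight G w own u v d)" for own u v d
    using inst by (intro vmove_encode_list) (simp add: valid_instance_def)
  have arcs: "valice_arc ?x (?enc u) (?enc v) = encode_arc ?W (2 * u, 2 * v + 1)"
    "vbob_arc ?x (?enc u) (?enc v) = encode_arc ?W (2 * u + 1, 2 * v)" for u v
    by (simp_all add: valice_arc_def vbob_arc_def encode_game_def' copies_Leaf pen move vnot_val_bool
        biclique_weight_def del: val_bool_simps)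
  have inner: "vfold (\<lambda>b acc. Node (valice_arc ?x (?enc u) b) (Node (vbob_arc ?x (?enc u) b) acc))
      (encode_list ?enc ns) (encode_list (encode_arc ?W) ys) = encode_list (encode_arc ?W)
      (concat (map (\<lambda>v. [(2 * u, 2 * v + 1), (2 * u + 1, 2 * v)]) (rev ns)) @ ys)" for u ys
    by (rule vfold_encode_list) (simp only: arcs encode_list_simps append.simps)
  have "varcs ?x = encode_list (encode_arc ?W) (concat (map (\<lambda>u. concat (map (\<lambda>v.
      [(2 * u, 2 * v + 1), (2 * u + 1, 2 * v)]) (rev ns))) (rev ns)) @ [])"
  proof -
    have left: "val_left ?x = encode_list ?enc ns"
      by (simp add: encode_game_def')
    show ?thesis
      unfolding varcs_def left encode_list_simps(1)[symmetric, of "encode_arc ?W"]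
      by (rule vfold_encode_list) (rule inner)
  qed
  then have "varcs ?x = encode_list (encode_arc ?W) (biclique_arcs ns)"
    by (simp add: biclique_arcs_def)
  with nodes show ?thesis
    unfolding vquery_def encode_game_def' by simp
qed

lemma vanswer_encode_game:
  assumes inst: "valid_instance G ns es"
  shows "vanswer (Node (encode_game G w ns es) (encode_list
      (\<lambda>u. encode_energy (min_energy (biclique G) (biclique_weight G w) u)) (biclique_nodes ns))) =
    encode_list (\<lambda>u. encode_energy (min_energy G w u)) ns"
proof -
  let ?E = "\<lambda>u. encode_energy (min_energy (biclique G) (biclique_weight G w) u)"
  let ?T = "\<lambda>u. encode_energy (min_energy G w u)"
  let ?enc = "\<lambda>u. Node (Leaf (int u)) (val_bool (u \<in> alice G))"
  define g where "g = (\<lambda>(a::val) acc. Node (val_right (val_right (val_left acc)))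
    (Node (vtruncate (Leaf (total_weight G w)) (val_left (val_left acc))) (val_right acc)))"
  have trunc: "vtruncate (Leaf (total_weight G w)) (?E (2 * u)) = ?T u" if "u \<in> set ns" for u
  proof -
    have u: "u \<in> pverts (arena G)" and G: "game_graph G"
      using that inst by (auto simp: valid_instance_def)
    show ?thesis
      using min_energy_biclique[OF G u, of w] total_weight_nonneg[of G w]
      by (cases "min_energy (biclique G) (biclique_weight G w) (2 * u)")
        (auto simp: vtruncate_def vle_def)
  qed
  \<comment> \<open>The induction runs over a part \<open>us\<close> of the nodes, while the
    threshold is that of the whole instance.\<close>
  have "vfold g (encode_list ?enc us) (Node (encode_list ?E (biclique_nodes us)) (encode_list ?T vs)) =
      Node (Leaf 0) (encode_list ?T (rev us @ vs))" if "set us \<subseteq> set ns" for us vs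
    using that
  proof (induction us arbitrary: vs)
    case (Cons u us)
    have "g (?enc u) (Node (encode_list ?E (biclique_nodes (u # us))) (encode_list ?T vs)) =
        Node (encode_list ?E (biclique_nodes us)) (encode_list ?T (u # vs))"
      using Cons.prems trunc[of u] by (simp add: g_def biclique_nodes_def)
    with Cons.IH[of "u # vs"] Cons.prems show ?case
      by simp
  qed (simp add: biclique_nodes_def)
  from this[of ns "[]"] have "vfold g (encode_list ?enc ns) (Node (encode_list ?E (biclique_nodes ns)) (Leaf 0)) =
      Node (Leaf 0) (encode_list ?T (rev ns))"
    by simp
  then show ?thesis
    by (simp add: vanswer_def encode_game_def' vtotal_instance[OF inst] vrev_encode_list g_def
        del: val_bool_simps)
qed

section \<open>Uniqueness and size of the answers\<close>

lemma energy_problem_altdef: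
  "energy_problem \<G> =
     {(encode_game G w ns es, encode_list (\<lambda>u. encode_energy (min_energy G w u)) ns) | G w ns es.
        G \<in> \<G> \<and> valid_instance G ns es}"
  by (simp add: energy_problem_def valid_instance_def)

text \<open>Node and arc names can be decoded, and Bob's vertices are those not marked as Alice's.
  Only the weights off the arcs are lost.\<close>

lemma encode_game_eqD:
  assumes eq: "encode_game G w ns es = encode_game G' w' ns' es'"
    and inst: "valid_instance G ns es" "valid_instance G' ns' es'"
  shows "G = G'" "ns = ns'" "\<And>e. e \<in> set es \<Longrightarrow> w e = w' e"
proof -
  have n: "map (\<lambda>u. Node (Leaf (int u)) (val_bool (u \<in> alice G))) ns =
      map (\<lambda>u. Node (Leaf (int u)) (val_bool (u \<in> alice G'))) ns'"
    and e: "map (encode_arc w) es = map (encode_arc w') es'"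
    using eq by (simp_all add: encode_game_def' encode_list_eq_iff)
  have "map (\<lambda>v. nat (val_int (val_left v))) (map (\<lambda>u. Node (Leaf (int u)) (val_bool (u \<in> alice G))) ns) = ns"
    "map (\<lambda>v. nat (val_int (val_left v))) (map (\<lambda>u. Node (Leaf (int u)) (val_bool (u \<in> alice G'))) ns') = ns'"
    by (simp_all add: comp_def)
  with n show ns: "ns = ns'"
    by metis
  have decode: "map (\<lambda>v. (nat (val_int (val_left (val_left v))), nat (val_int (val_right (val_left v)))))
      (map (encode_arc w) es) = es" for w es
    by (induction es) auto
  from decode[of w es] have es: "es = es'"
    unfolding e decode by (rule sym)
  have alice: "u \<in> alice G \<longleftrightarrow> u \<in> alice G'" if "u \<in> set ns" for u
    using n that unfolding ns by (auto simp: val_bool_def split: if_splits)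
  have sets: "set ns = pverts (arena G)" "set ns = pverts (arena G')"
    "set es = parcs (arena G)" "set es = parcs (arena G')" "game_graph G" "game_graph G'"
    using inst ns es by (auto simp: valid_instance_def)
  have "arena G = arena G'"
    by (rule pair_pre_digraph.equality) (use sets in simp_all)
  moreover have "alice G \<subseteq> set ns" "alice G' \<subseteq> set ns"
    using sets game_graph_simps(5)[OF sets(5)] game_graph_simps(5)[OF sets(6)] by auto
  with alice have "alice G = alice G'"
    by blast
  moreover have "bob G = pverts (arena G) - alice G" "bob G' = pverts (arena G') - alice G'"
    using game_graph_simps(5,6)[OF sets(5)] game_graph_simps(5,6)[OF sets(6)] by auto
  ultimately show "G = G'"
    by simp
  show "w e = w' e" if "e \<in> set es" for e
    using e that unfolding es by (cases e) auto
qed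

text \<open>An oracle's answer is justified by some game with the same encoding; it is thereby the
  answer for the game at hand.\<close>

lemma energy_problem_answer_unique:
  assumes "(encode_game G w ns es, v) \<in> energy_problem \<G>" "valid_instance G ns es"
  shows "v = encode_list (\<lambda>u. encode_energy (min_energy G w u)) ns"
proof -
  obtain G' w' ns' es' where *: "encode_game G w ns es = encode_game G' w' ns' es'"
    "v = encode_list (\<lambda>u. encode_energy (min_energy G' w' u)) ns'" "valid_instance G' ns' es'"
    using assms(1) by (auto simp: energy_problem_altdef)
  note eq = encode_game_eqD[OF *(1) assms(2) *(3)]
  have "min_energy G w u = min_energy G w' u" if "u \<in> set ns" for u
    using assms(2) eq(3) that by (intro min_energy_cong) (auto simp: valid_instance_def)
  then show ?thesis
    using *(2) eq(1,2) by (auto simp: encode_list_eq_iff)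
qed

lemma bit_size_encode_list_le:
  assumes "\<And>x. x \<in> set xs \<Longrightarrow> bit_size (enc x) \<le> m"
  shows "bit_size (encode_list enc xs) \<le> 1 + length xs * (1 + m)"
  using assms by (induction xs) (force simp: floorlog_def)+

lemma length_le_bit_size_encode_list: "length xs \<le> bit_size (encode_list enc xs)"
  by (induction xs) auto

lemma bit_size_total_weight:
  "bit_size (Leaf (\<Sum>e\<leftarrow>es. \<bar>w e\<bar>)) \<le> bit_size (encode_list (encode_arc w) es)"
proof (induction es)
  case (Cons e es)
  have "bit_size (Leaf \<bar>w e\<bar>) \<le> bit_size (encode_arc w e)"
    by (cases e) simp
  with Cons bit_size_Leaf_add[of "\<bar>w e\<bar>" "\<Sum>e\<leftarrow>es. \<bar>w e\<bar>"] show ?case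
    by (simp del: bit_size.simps(1))
qed simp

text \<open>Oracle answers are charged by size. A finite energy is at most the total weight, which
  has no more bits than the list of arcs.\<close>

lemma energy_problem_answer_size:
  obtains r :: "nat poly"
  where "\<And>x v \<G>. (x, v) \<in> energy_problem \<G> \<Longrightarrow> bit_size v \<le> poly r (bit_size x)"
proof
  fix x v \<G> assume xv: "(x, v) \<in> energy_problem \<G>"
  obtain G w ns es where x: "x = encode_game G w ns es"
    and v: "v = encode_list (\<lambda>u. encode_energy (min_energy G w u)) ns"
    and inst: "valid_instance G ns es"
    using xv by (auto simp: energy_problem_altdef)
  have total: "bit_size (Leaf (total_weight G w)) \<le> bit_size x"
    using bit_size_total_weight[of w es] inst
    by (simp add: x encode_game_def' total_weight_def valid_instance_def
        sum_list_distinct_conv_sum_set del: bit_size.simps(1))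
  have "bit_size (encode_energy (min_energy G w u)) \<le> 2 + bit_size x" if "u \<in> set ns" for u
  proof (cases "min_energy G w u")
    case (enat n)
    have "min_energy G w u \<le> enat (nat (total_weight G w))"
      using inst that enat by (intro finite_min_energy_le_total_weight) (auto simp: valid_instance_def)
    then have "int n \<le> total_weight G w"
      using enat total_weight_nonneg[of G w] by simp
    then have "bit_size (Leaf (int n)) \<le> bit_size (Leaf (total_weight G w))"
      by (intro bit_size_Leaf_mono) simp
    with total enat show ?thesis
      by (simp del: bit_size.simps(1))
  qed (simp add: floorlog_def)
  then have "bit_size v \<le> 1 + length ns * (1 + (2 + bit_size x))"
    unfolding v by (rule bit_size_encode_list_le)
  moreover have "length ns \<le> bit_size x"
    unfolding x encode_game_def' bit_size.simps(2)
    using length_le_bit_size_encode_list trans_le_add1 trans_le_add2 by blast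
  then have "length ns * (1 + (2 + bit_size x)) \<le> bit_size x * (1 + (2 + bit_size x))"
    by (rule mult_right_mono) simp
  ultimately show "bit_size v \<le> poly ([:1:] + [:0, 1:] * [:3, 1:]) (bit_size x)"
    by (simp add: algebra_simps)
qed


section \<open>The equivalences\<close>

text \<open>A restricted instance is an instance, so the input itself is the query; by uniqueness
  the oracle's answer is correct for the restricted problem as well.\<close>

lemma poly_time_reducible_UNIV: "poly_time_reducible (energy_problem \<G>) (energy_problem UNIV)"
proof -
  obtain q :: "nat poly" where q: "\<And>x v \<G>. (x, v) \<in> energy_problem \<G> \<Longrightarrow> bit_size v \<le> poly q (bit_size x)"
    using energy_problem_answer_size by metis
  have "\<exists>t s. exec f (Query 0 (Var 0)) ((\<lambda>_. Leaf 0)(0 := x)) t s \<and>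
      t \<le> poly ([:1, 1:] + q) (bit_size x) \<and> (x, s 0) \<in> energy_problem \<G>"
    if f: "oracle_for f (energy_problem UNIV)" and x: "x \<in> Domain (energy_problem \<G>)" for f x
  proof -
    obtain G w ns es where x_eq: "x = encode_game G w ns es" and inst: "G \<in> \<G>" "valid_instance G ns es"
      using x by (auto simp: energy_problem_altdef)
    then have "x \<in> Domain (energy_problem UNIV)"
      unfolding energy_problem_altdef by blast
    then have ans: "(x, f x) \<in> energy_problem UNIV"
      using f by (simp add: oracle_for_def)
    then have "f x = encode_list (\<lambda>u. encode_energy (min_energy G w u)) ns"
      using energy_problem_answer_unique inst unfolding x_eq by blast
    then have "(x, f x) \<in> energy_problem \<G>"
      using inst by (auto simp: energy_problem_altdef x_eq)
    moreover have "bit_size (f x) \<le> poly q (bit_size x)"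
      by (rule q[OF ans])
    moreover have "exec f (Query 0 (Var 0)) ((\<lambda>_. Leaf 0)(0 := x))
        (1 + bit_size x + bit_size (f x)) ((\<lambda>_. Leaf 0)(0 := f x))"
      using exec_Query[of f 0 "Var 0" "(\<lambda>_. Leaf 0)(0 := x)"] by simp
    ultimately show ?thesis
      by (intro exI[of _ "1 + bit_size x + bit_size (f x)"] exI[of _ "(\<lambda>_. Leaf 0)(0 := f x)"]) simp
  qed
  then show ?thesis
    unfolding poly_time_reducible_def by blast
qed

text \<open>A single query suffices. The input is kept beside the answer, because the truncation
  needs the nodes and the total weight.\<close>

lemma poly_time_reducible_biclique:
  assumes "\<And>G. game_graph G \<Longrightarrow> biclique G \<in> \<G>"
  shows "poly_time_reducible (energy_problem UNIV) (energy_problem \<G>)"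
proof -
  obtain c\<^sub>1 N\<^sub>1 p\<^sub>1 c\<^sub>2 N\<^sub>2 p\<^sub>2 where c: "computes c\<^sub>1 N\<^sub>1 p\<^sub>1 vquery" "computes c\<^sub>2 N\<^sub>2 p\<^sub>2 vanswer"
    using polytime_vquery polytime_vanswer by (auto simp: polytime_def)
  obtain r :: "nat poly" where r: "\<And>x v \<G>. (x, v) \<in> energy_problem \<G> \<Longrightarrow> bit_size v \<le> poly r (bit_size x)"
    using energy_problem_answer_size by metis
  define a where "a = Suc N\<^sub>1"
  have a: "a \<noteq> 0" "N\<^sub>1 \<le> a"
    by (simp_all add: a_def)
  define prog where "prog = Seq (Assign a (Var 0)) (Seq c\<^sub>1 (Seq (Query 0 (Var 0))
    (Seq (Assign 0 (MkNode (Var a) (Var 0))) c\<^sub>2)))"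
  \<comment> \<open>A bound on the oracle's answer: \<open>r\<close> at the size of the query, which
    exceeds the input size by at most the time spent on computing it.\<close>
  define q where "q = pcompose r ([:0, 1:] + p\<^sub>1)"
  define p where "p = [:20, 20:] + smult 20 p\<^sub>1 + smult 20 q + pcompose p\<^sub>2 ([:1, 1:] + q)"
  have "\<exists>t s. exec f prog ((\<lambda>_. Leaf 0)(0 := x)) t s \<and> t \<le> poly p (bit_size x) \<and>
      (x, s 0) \<in> energy_problem UNIV"
    if f: "oracle_for f (energy_problem \<G>)" and x: "x \<in> Domain (energy_problem UNIV)" for f x
  proof -
    let ?n = "bit_size x"
    obtain G w ns es where x_eq: "x = encode_game G w ns es" and inst: "valid_instance G ns es"
      using x by (auto simp: energy_problem_altdef)
    let ?y = "vquery x"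
    note inst' = valid_instance_biclique[OF inst]
    have y_eq: "?y = encode_game (biclique G) (biclique_weight G w) (biclique_nodes ns) (biclique_arcs ns)"
      unfolding x_eq by (rule vquery_encode_game[OF inst])
    have "biclique G \<in> \<G>"
      using inst by (intro assms) (simp add: valid_instance_def)
    with inst' have "?y \<in> Domain (energy_problem \<G>)"
      unfolding y_eq energy_problem_altdef by blast
    then have ans: "(?y, f ?y) \<in> energy_problem \<G>"
      using f by (simp add: oracle_for_def)
    have "f ?y = encode_list (\<lambda>u. encode_energy (min_energy (biclique G) (biclique_weight G w) u))
        (biclique_nodes ns)"
      using energy_problem_answer_unique[OF ans[unfolded y_eq] inst'] unfolding y_eq .
    then have "vanswer (Node x (f ?y)) = encode_list (\<lambda>u. encode_energy (min_energy G w u)) ns"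
      unfolding x_eq by (simp only: vanswer_encode_game[OF inst])
    then have correct: "(x, vanswer (Node x (f ?y))) \<in> energy_problem UNIV"
      using inst by (auto simp: energy_problem_altdef x_eq)
    define s\<^sub>0 :: state where "s\<^sub>0 = (\<lambda>_. Leaf 0)(0 := x)"
    define s\<^sub>1 where "s\<^sub>1 = s\<^sub>0(a := x)"
    have s: "s\<^sub>0 0 = x" "s\<^sub>1 0 = x" "s\<^sub>1 a = x"
      using a by (simp_all add: s\<^sub>0_def s\<^sub>1_def)
    have e\<^sub>1: "exec f (Assign a (Var 0)) s\<^sub>0 (1 + ?n) s\<^sub>1"
      using exec_Assign[of f a "Var 0" s\<^sub>0] s by (simp add: s\<^sub>1_def)
    obtain t\<^sub>2 s\<^sub>2 where 2: "exec f c\<^sub>1 s\<^sub>1 t\<^sub>2 s\<^sub>2" "t\<^sub>2 \<le> poly p\<^sub>1 ?n" "s\<^sub>2 0 = ?y"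
      "\<And>v. N\<^sub>1 \<le> v \<Longrightarrow> s\<^sub>2 v = s\<^sub>1 v" "bit_size ?y \<le> ?n + poly p\<^sub>1 ?n"
      using computesE[OF c(1), where s = s\<^sub>1] s by metis
    have s\<^sub>2a: "s\<^sub>2 a = x"
      using 2(4) a s by simp
    have e\<^sub>3: "exec f (Query 0 (Var 0)) s\<^sub>2 (1 + bit_size ?y + bit_size (f ?y)) (s\<^sub>2(0 := f ?y))"
      using exec_Query[of f 0 "Var 0" s\<^sub>2] 2(3) by simp
    define s\<^sub>4 where "s\<^sub>4 = s\<^sub>2(0 := Node x (f ?y))"
    have e\<^sub>4: "exec f (Assign 0 (MkNode (Var a) (Var 0))) (s\<^sub>2(0 := f ?y))
        (1 + (?n + bit_size (f ?y) + (1 + ?n + bit_size (f ?y)))) s\<^sub>4"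
      using exec_Assign[of f 0 "MkNode (Var a) (Var 0)" "s\<^sub>2(0 := f ?y)"] s\<^sub>2a a by (simp add: s\<^sub>4_def)
    obtain t\<^sub>5 s\<^sub>5 where 5: "exec f c\<^sub>2 s\<^sub>4 t\<^sub>5 s\<^sub>5" "t\<^sub>5 \<le> poly p\<^sub>2 (1 + ?n + bit_size (f ?y))"
      "s\<^sub>5 0 = vanswer (Node x (f ?y))"
      by (rule computesE[OF c(2), where s = s\<^sub>4 and f = f]) (auto simp: s\<^sub>4_def)
    have fy: "bit_size (f ?y) \<le> poly q ?n"
      using r[OF ans] poly_nat_mono[OF 2(5), of r] by (simp add: q_def poly_pcompose)
    then have "t\<^sub>5 \<le> poly p\<^sub>2 (1 + ?n + poly q ?n)"
      using 5(2) poly_nat_mono[of "1 + ?n + bit_size (f ?y)" "1 + ?n + poly q ?n" p\<^sub>2] by linarith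
    then have time: "1 + (1 + ?n) + (1 + t\<^sub>2 + (1 + (1 + bit_size ?y + bit_size (f ?y)) + (1 +
        (1 + (?n + bit_size (f ?y) + (1 + ?n + bit_size (f ?y)))) + t\<^sub>5))) \<le> poly p ?n"
      using 2(2,5) fy by (simp add: p_def poly_pcompose)
    note run = exec_Seq[OF e\<^sub>1 exec_Seq[OF 2(1) exec_Seq[OF e\<^sub>3 exec_Seq[OF e\<^sub>4 5(1)]]]]
    show ?thesis
    proof (intro exI conjI, rule run[folded prog_def, unfolded s\<^sub>0_def])
      show "(x, s\<^sub>5 0) \<in> energy_problem UNIV"
        using correct 5(3) by simp
    qed (rule time)
  qed
  then show ?thesis
    unfolding poly_time_reducible_def by blast
qed

theorem theorem4:
  shows "(\<exists>k. poly_time_equivalent (energy_problem UNIV)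
                (energy_problem {G. clique_width (arena G) \<le> k}))
    \<and> poly_time_equivalent (energy_problem UNIV) (energy_problem {G. strongly_ergodic G})"
  unfolding poly_time_equivalent_def
  by (intro conjI exI[of _ 2] poly_time_reducible_biclique poly_time_reducible_UNIV)
    (simp_all add: clique_width_biclique strongly_ergodic_biclique)

end
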